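(* Let $n,m\ge1$ be integers, let $\psi:\mathbb{N}\to\mathbb{R}^+$ be a function, let $\mathbf{y}\in\mathbb{I}^m$, and let $f$ and $g:r\mapsto g(r):=r^{-m(n-1)}f(r)$ be dimension functions such that $r^{-nm}f(r)$ is monotonic. Define $\theta:\mathbb{N}\to\mathbb{R}^+$ by $\theta(r)=r\,g\!\left(\frac{\psi(r)}{r}\right)^{1/m}$. If $|\mathcal{A}^{\mathbf{y}}_{n,m}(\theta)|=1$, then $\mathcal{H}^f(\mathcal{A}^{\mathbf{y}}_{n,m}(\psi))=\mathcal{H}^f(\mathbb{I}^{nm})$.
   Context: $\mathbb{I}^d=[0,1]^d$; $|X|$ denotes Lebesgue measure. Points $\mathbf{x}\in\mathbb{I}^{nm}$ are real $n\times m$ matrices; $\mathbf{q}\in\mathbb{Z}^n$ is a row vector, $\mathbf{p}\in\mathbb{Z}^m$; $|\cdot|$ is the supremum norm. For $\phi:\mathbb{N}\to\mathbb{R}^+$, $\mathcal{A}^{\mathbf{y}}_{n,m}(\phi)$ is the set of $\mathbf{x}\in\mathbb{I}^{nm}$ such that $|\mathbf{q}\mathbf{x}+\mathbf{p}-\mathbf{y}|<\phi(|\mathbf{q}|)$ for infinitely many $(\mathbf{p},\mathbf{q})\in(\mathbb{Z}^m\times\mathbb{Z}^n)\setminus\{\mathbf{0}\}$. A dimension function is a left continuous, non-decreasing $f:\mathbb{R}^+\to\mathbb{R}^+$ with $f(r)\to0$ as $r\to0$; $\mathcal{H}^f$ is Hausdorff $f$-measure. *)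

theory Defs
  imports "HOL-Analysis.Analysis"
begin

text \<open>Positive reals are the open half-line; values of \<open>f\<close> at arguments \<open>\<le> 0\<close> are never used.\<close>

definition dimension_function :: "(real \<Rightarrow> real) \<Rightarrow> bool" where
  "dimension_function f \<longleftrightarrow>
     (\<forall>r>0. f r > 0) \<and>
     (\<forall>r>0. continuous (at_left r) f) \<and>
     mono_on {0<..} f \<and>
     (f \<longlongrightarrow> 0) (at_right 0)"

text \<open>The convention \<open>f 0 = 0\<close> is built in, so empty sets and singletons cost nothing whatever
  junk value \<open>f\<close> takes at \<open>0\<close>.\<close>

definition gauge_cost :: "(real \<Rightarrow> real) \<Rightarrow> 'a::metric_space set \<Rightarrow> ennreal" where
  "gauge_cost f U = (if diameter U = 0 then 0 else ennreal (f (diameter U)))"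

text \<open>Boundedness has to be required separately, since \<open>diameter\<close> is unspecified on unbounded sets.
  Covers indexed by \<open>nat\<close> include the finite ones, by padding with the empty set.\<close>

definition hausdorff_premeasure :: "(real \<Rightarrow> real) \<Rightarrow> real \<Rightarrow> 'a::metric_space set \<Rightarrow> ennreal" where
  "hausdorff_premeasure f \<delta> X =
     Inf {(\<Sum>i. gauge_cost f (U i)) | U :: nat \<Rightarrow> 'a set.
            X \<subseteq> (\<Union>i. U i) \<and> (\<forall>i. bounded (U i) \<and> diameter (U i) \<le> \<delta>)}"

definition hausdorff_measure :: "(real \<Rightarrow> real) \<Rightarrow> 'a::metric_space set \<Rightarrow> ennreal" where
  "hausdorff_measure f X = (SUP \<delta>\<in>{0<..}. hausdorff_premeasure f \<delta> X)"

abbreviation unit_cube :: "'a::euclidean_space set" where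
  "unit_cube \<equiv> cbox 0 One"

definition real_vec :: "int ^ 'k \<Rightarrow> real ^ 'k" where
  "real_vec v = (\<chi> i. real_of_int (v $ i))"

text \<open>The supremum norm of an integer vector as a natural number, so that it can be fed to
  functions on \<open>nat\<close>; on real vectors the supremum norm is \<open>infnorm\<close>.\<close>

definition int_supnorm :: "int ^ 'k \<Rightarrow> nat" where
  "int_supnorm v = Max (range (\<lambda>i. nat \<bar>v $ i\<bar>))"

text \<open>An \<open>n \<times> m\<close> matrix has type \<open>real ^ 'm ^ 'n\<close>. Pairs with \<open>q = 0\<close> are not excluded, but only
  finitely many of them satisfy the inequality, so the value \<open>\<phi> 0\<close> has no influence on the set.\<close>

definition approximable :: "real ^ 'm \<Rightarrow> (nat \<Rightarrow> real) \<Rightarrow> (real ^ 'm ^ 'n) set" where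
  "approximable y \<phi> =
     {x \<in> unit_cube.
        infinite {(p :: int ^ 'm, q :: int ^ 'n).
          (p, q) \<noteq> (0, 0) \<and>
          infnorm (real_vec q v* x + real_vec p - y) < \<phi> (int_supnorm q)}}"

end

theory Submission
  imports Defs
begin

text \<open>
  If \<open>\<psi> r \<ge> 1\<close> infinitely often, every point is approximable. Otherwise \<open>\<psi> r / r \<rightarrow> 0\<close>, and there are two
  cases. If \<open>f r = O(r ^ (n m))\<close> near \<open>0\<close>, then \<open>\<theta> = O(\<psi>)\<close>, each \<open>\<theta>\<close>-neighbourhood of a plane contains a
  proportional ball of the \<open>\<psi>\<close>-neighbourhood, a Vitali argument shows that the \<open>\<psi>\<close>-approximable set has full
  measure, and Lebesgue null sets are null for the Hausdorff measure. Otherwise \<open>r ^ (- n m) * f r\<close> increases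
  to infinity as \<open>r\<close> decreases to \<open>0\<close> and the Hausdorff measure is infinite, which is proved without
  constructing a measure: given a cover by balls of radii \<open>d k \<le> \<delta>\<close> with finite total cost, one finds
  nested balls, each inside a \<open>\<psi>\<close>-neighbourhood of a plane and met only by covering balls of total cost
  small compared with its own; their common point is approximable and not covered. For the inductive step,
  suppose that all such small balls inside an open set \<open>U\<close> are expensive. Near almost every point of
  \<open>U\<close> off the enlarged covering balls there is a plane, and covering a grid of small balls along it at scale
  \<open>\<rho> = \<theta>(|q|)/|q|\<close> costs at least a constant times \<open>\<rho> ^ (n m)\<close>, using only late members of the cover. By Vitali
  the enlarged covering balls then exhaust \<open>U\<close>, contradicting a volume count.
\<close>

subsection \<open>Sums and Vitali coverings\<close>

text \<open>Double counting: once the two sums are interchanged, \<open>w k\<close> appears once for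
  every \<open>H z\<close> containing \<open>k\<close>. It is applied with multiplicity at most one,
  for disjoint balls, and with the number of grid balls met by one covering ball.\<close>

lemma sum_infsum_le_infsum:
  fixes w v :: "'k \<Rightarrow> real"
  assumes "finite Z" and w: "\<And>z. z \<in> Z \<Longrightarrow> w summable_on H z" and v: "v summable_on A"
    and sub: "\<And>z. z \<in> Z \<Longrightarrow> H z \<subseteq> A"
    and le: "\<And>k. k \<in> A \<Longrightarrow> real (card {z \<in> Z. k \<in> H z}) * w k \<le> v k"
  shows "(\<Sum>z\<in>Z. infsum w (H z)) \<le> infsum v A"
proof -
  define F where "F z k = (if k \<in> H z then w k else 0)" for z k
  \<comment> \<open>Extending \<open>w\<close> by zero puts all sums over the common index set
    \<open>A\<close>, where finitely many of them can be added.\<close>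
  have hs: "(F z has_sum infsum w (H z)) A" if "z \<in> Z" for z
  proof -
    have "(w has_sum infsum w (H z)) (H z)"
      using w[OF that] by (rule has_sum_infsum)
    then show ?thesis
      by (rule has_sum_cong_neutral[THEN iffD1, rotated 3]) (use sub[OF that] in \<open>auto simp: F_def\<close>)
  qed
  have "Z' \<subseteq> Z \<Longrightarrow> ((\<lambda>k. \<Sum>z\<in>Z'. F z k) has_sum (\<Sum>z\<in>Z'. infsum w (H z))) A"
    if "finite Z'" for Z'
    using that
  proof induction
    case (insert z Z')
    then show ?case
      using has_sum_add[OF hs[of z], of "\<lambda>k. \<Sum>z\<in>Z'. F z k"] by simp
  qed auto
  then have sum: "((\<lambda>k. \<Sum>z\<in>Z. F z k) has_sum (\<Sum>z\<in>Z. infsum w (H z))) A"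
    using \<open>finite Z\<close> by blast
  have "(\<Sum>z\<in>Z. F z k) = real (card {z \<in> Z. k \<in> H z}) * w k" for k
    by (simp add: F_def sum.If_cases \<open>finite Z\<close> Int_def)
  with le have "\<And>k. k \<in> A \<Longrightarrow> (\<Sum>z\<in>Z. F z k) \<le> v k"
    by simp
  then show ?thesis
    using has_sum_mono[OF sum has_sum_infsum[OF v]] by blast
qed

text \<open>Truncation at \<open>b\<close> either changes no term or leaves a term equal to
  \<open>b\<close>, which alone is at least \<open>c\<close>.\<close>

lemma infsum_min_ge:
  fixes w :: "'k \<Rightarrow> real"
  assumes w: "w summable_on A" and nonneg: "\<And>k. k \<in> A \<Longrightarrow> 0 \<le> w k"
    and "0 \<le> b" "c \<le> b" "c \<le> infsum w A"
  shows "c \<le> infsum (\<lambda>k. min (w k) b) A"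
proof (cases "\<exists>k\<in>A. w k \<ge> b")
  case True
  then obtain k where k: "k \<in> A" "w k \<ge> b" by blast
  have "(\<lambda>k. min (w k) b) summable_on A"
    by (rule summable_on_comparison_test[OF w]) (use nonneg \<open>0 \<le> b\<close> in auto)
  then have "sum (\<lambda>k. min (w k) b) {k} \<le> infsum (\<lambda>k. min (w k) b) A"
    by (rule finite_sum_le_infsum) (use k nonneg \<open>0 \<le> b\<close> in auto)
  then have "b \<le> infsum (\<lambda>k. min (w k) b) A" using k by simp
  with \<open>c \<le> b\<close> show ?thesis by linarith
next
  case False
  then have "infsum (\<lambda>k. min (w k) b) A = infsum w A"
    by (intro infsum_cong) auto
  with assms show ?thesis by simp
qed

lemma infsum_small_outside_finite:
  fixes w :: "'k \<Rightarrow> real"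
  assumes w: "w summable_on A" and nonneg: "\<And>k. k \<in> A \<Longrightarrow> 0 \<le> w k" and "0 < e"
  obtains F where "finite F" "F \<subseteq> A" "\<And>B. B \<subseteq> A - F \<Longrightarrow> infsum w B \<le> e"
proof -
  obtain F where F: "finite F" "F \<subseteq> A" "dist (sum w F) (infsum w A) \<le> e"
    using infsum_finite_approximation[OF w \<open>0 < e\<close>] by blast
  have "infsum w B \<le> e" if "B \<subseteq> A - F" for B
  proof -
    have s: "w summable_on A - F" "w summable_on F"
      using summable_on_subset_banach[OF w] F by auto
    have "infsum w B \<le> infsum w (A - F)"
      by (rule infsum_mono2) (use that s summable_on_subset_banach[OF w] nonneg in auto)
    also have "\<dots> = infsum w A - infsum w F"
      by (rule infsum_Diff[OF w s(2) F(2)])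
    also have "\<dots> \<le> e" using F by (simp add: dist_real_def)
    finally show ?thesis .
  qed
  with F that show ?thesis by blast
qed

text \<open>\<open>T\<close> is the union of a countable disjoint Vitali subfamily of balls
  satisfying \<open>P\<close>. A volume bound for its finite subfamilies passes to the whole union,
  so later only finite sums have to be estimated.\<close>

lemma Vitali_measure_bound:
  fixes W :: "'a::euclidean_space set"
  assumes fine: "\<And>x d. x \<in> W \<Longrightarrow> 0 < d \<Longrightarrow> \<exists>r>0. r < d \<and> P x r"
    and bound: "\<And>F. finite F \<Longrightarrow> (\<And>x r. (x, r) \<in> F \<Longrightarrow> 0 < r \<and> P x r) \<Longrightarrow>
      pairwise (\<lambda>(x, r) (x', r'). disjnt (cball x r) (cball x' r')) F \<Longrightarrow>
      (\<Sum>(x, r)\<in>F. measure lebesgue (cball x r)) \<le> B"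
  obtains T where "T \<in> lmeasurable" "measure lebesgue T \<le> B" "negligible (W - T)"
proof -
  define K where "K = {(x, r). 0 < r \<and> P x r}"
  have pos: "0 < snd i" if "i \<in> K" for i
    using that by (auto simp: K_def)
  have cov: "\<exists>i. i \<in> K \<and> x \<in> cball (fst i) (snd i) \<and> snd i < d" if "x \<in> W" "0 < d" for x d
    using fine[OF that] unfolding K_def by force
  obtain C where C: "countable C" "C \<subseteq> K"
    "pairwise (\<lambda>i j. disjnt (cball (fst i) (snd i)) (cball (fst j) (snd j))) C"
    "negligible (W - (\<Union>i\<in>C. cball (fst i) (snd i)))"
    by (rule Vitali_covering_theorem_cballs[of K snd W fst, OF pos cov])
  have *: "measure lebesgue (\<Union>i\<in>F. cball (fst i) (snd i)) \<le> B" if "F \<subseteq> C" "finite F" for F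
  proof -
    have "measure lebesgue (\<Union>i\<in>F. cball (fst i) (snd i)) \<le> (\<Sum>i\<in>F. measure lebesgue (cball (fst i) (snd i)))"
      by (rule measure_UNION_le[OF that(2)]) auto
    also have "\<dots> = (\<Sum>(x, r)\<in>F. measure lebesgue (cball x r))"
      by (simp add: case_prod_unfold)
    also have "\<dots> \<le> B"
    proof (rule bound[OF that(2)])
      show "pairwise (\<lambda>(x, r) (x', r'). disjnt (cball x r) (cball x' r')) F"
        using pairwise_subset[OF C(3) that(1)] by (simp add: case_prod_unfold)
    qed (use that C(2) in \<open>auto simp: K_def\<close>)
    finally show ?thesis .
  qed
  have m: "cball (fst i) (snd i) \<in> lmeasurable" for i :: "'a \<times> real"
    by simp
  show ?thesis
    by (rule that[OF fmeasurable_UN_bound[OF C(1) m *] measure_UN_bound[OF C(1) m *] C(4)])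
qed

subsection \<open>Covers of limsup sets\<close>

lemma cballs_meet:
  fixes z u :: "'a::real_normed_vector"
  assumes "0 < s" "0 < d" "dist z u \<le> d + s"
  shows "cball z s \<inter> cball u d \<noteq> {}"
proof -
  \<comment> \<open>The point dividing the segment from \<open>z\<close> to \<open>u\<close> in the
    ratio \<open>s : d\<close>.\<close>
  define p where "p = z + (s / (d + s)) *\<^sub>R (u - z)"
  have "u - p = (1 - s / (d + s)) *\<^sub>R (u - z)"
    by (simp add: p_def algebra_simps)
  also have "1 - s / (d + s) = d / (d + s)" using assms by (simp add: field_simps)
  finally have "dist u p = d * (dist z u / (d + s))"
    using assms by (simp add: dist_norm norm_minus_commute)
  moreover have "dist z p = s * (dist z u / (d + s))"
    using assms by (simp add: p_def dist_norm norm_minus_commute)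
  moreover have "dist z u / (d + s) \<le> 1" using assms by simp
  ultimately have "dist z p \<le> s" "dist u p \<le> d"
    using assms mult_left_le[of "dist z u / (d + s)" s] mult_left_le[of "dist z u / (d + s)" d]
    by linarith+
  then show ?thesis by auto
qed

text \<open>
  \<open>E\<close> plays the role of the large limsup set: arbitrarily close to each of its points there is a
  well-spread family \<open>Z\<close> of centres of small balls lying in the target sets \<open>T N\<close>. In the application
  \<open>\<rho> = \<theta>(|q|)/|q|\<close>, \<open>r = \<psi>(|q|)/|q|\<close> and \<open>Z\<close> is a grid of mesh \<open>r\<close> on the plane \<open>qz + p = y\<close>, whose
  dimension is \<open>m\<close> here.
\<close>

locale grid_system =
  fixes f g :: "real \<Rightarrow> real" and m :: nat and C \<kappa> :: real
    and T :: "nat \<Rightarrow> 'a::euclidean_space set set" and E :: "'a set"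
  assumes f_pos: "0 < r \<Longrightarrow> 0 < f r"
    and f_mono: "0 < r \<Longrightarrow> r \<le> s \<Longrightarrow> f r \<le> f s"
    and f_quot: "0 < r \<Longrightarrow> r \<le> s \<Longrightarrow> f s * r ^ DIM('a) \<le> f r * s ^ DIM('a)"
    and g_mono: "0 < r \<Longrightarrow> r \<le> s \<Longrightarrow> g r \<le> g s"
    and f_eq: "0 < r \<Longrightarrow> f r = r ^ m * g r"
    and C_pos: "0 < C" and \<kappa>: "0 < \<kappa>" "\<kappa> \<le> 1/2"
    and grid: "x \<in> E \<Longrightarrow> 0 < e \<Longrightarrow> \<exists>r \<rho> Z. 0 < r \<and> r \<le> \<rho> \<and> \<rho> < e \<and>
      \<rho> ^ DIM('a) = \<rho> ^ m * g r \<and> finite Z \<and> (\<rho> / (2 * r)) ^ m \<le> card Z \<and> Z \<subseteq> cball x (C * \<rho>) \<and>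
      (\<forall>z\<in>Z. \<exists>S\<in>T N. cball z (\<kappa> * r) \<subseteq> S) \<and>
      (\<forall>u d. 0 \<le> d \<longrightarrow> card {z \<in> Z. dist z u \<le> d + \<kappa> * r} \<le> (4 * d / r + 3) ^ m)"
begin

text \<open>
  A covering ball of radius \<open>d k \<ge> r\<close> meets about \<open>(d k / r) ^ m\<close> balls of the grid. Since each of these
  charges it at most \<open>f r = r ^ m * g r\<close>, the total charge is at most of order
  \<open>d k ^ m * g r \<le> f (d k)\<close>; this is why the costs are truncated at \<open>f r\<close>.
\<close>

lemma grid_cost:
  fixes u :: "'k \<Rightarrow> 'a" and d :: "'k \<Rightarrow> real"
  assumes "finite Z" "0 < r"
    and count: "\<And>u d. 0 \<le> d \<Longrightarrow> card {z \<in> Z. dist z u \<le> d + \<kappa> * r} \<le> (4 * d / r + 3) ^ m"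
    and d: "\<And>k. 0 < d k" and summ: "(\<lambda>k. f (d k)) summable_on UNIV"
    and c: "0 < c" "c \<le> 1"
    and cost: "\<And>z. z \<in> Z \<Longrightarrow> c * f (\<kappa> * r) \<le> infsum (\<lambda>k. f (d k)) {k. dist z (u k) \<le> d k + \<kappa> * r}"
  shows "card Z * (c * f (\<kappa> * r)) \<le> 7 ^ m * infsum (\<lambda>k. f (d k)) {k. \<exists>z\<in>Z. dist z (u k) \<le> d k + \<kappa> * r}"
    (is "_ \<le> _ * infsum _ ?A")
proof -
  define w where "w k = min (f (d k)) (f r)" for k
  let ?H = "\<lambda>z. {k. dist z (u k) \<le> d k + \<kappa> * r}"
  have f_d: "0 < f (d k)" for k using f_pos d by blast
  have summ_sub: "(\<lambda>k. f (d k)) summable_on B" for B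
    using summable_on_subset_banach[OF summ] by blast
  have w_sub: "w summable_on B" for B
    by (rule summable_on_comparison_test[OF summ_sub])
      (use f_d f_pos[OF \<open>0 < r\<close>] in \<open>auto simp: w_def intro: less_imp_le\<close>)
  \<comment> \<open>The truncation level \<open>f r\<close> is at least the cost demanded of one
    grid ball, so the truncated costs still meet the demand.\<close>
  have le_fr: "c * f (\<kappa> * r) \<le> f r"
  proof -
    have "f (\<kappa> * r) \<le> f r" using \<kappa> \<open>0 < r\<close> by (intro f_mono) auto
    moreover have "c * f (\<kappa> * r) \<le> 1 * f (\<kappa> * r)"
      using c \<kappa> \<open>0 < r\<close> by (intro mult_right_mono less_imp_le[OF f_pos]) auto
    ultimately show ?thesis by linarith
  qed
  have "(\<Sum>z\<in>Z. c * f (\<kappa> * r)) \<le> (\<Sum>z\<in>Z. infsum w (?H z))"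
    unfolding w_def
    by (intro sum_mono infsum_min_ge)
      (use summ_sub f_d f_pos[OF \<open>0 < r\<close>] le_fr cost in \<open>auto intro: less_imp_le\<close>)
  also have "\<dots> \<le> infsum (\<lambda>k. 7 ^ m * f (d k)) ?A"
  proof (rule sum_infsum_le_infsum)
    fix k
    have k: "real (card {z \<in> Z. k \<in> ?H z}) \<le> (4 * d k / r + 3) ^ m"
      using count[of "d k" "u k"] d[of k] by simp
    show "real (card {z \<in> Z. k \<in> ?H z}) * w k \<le> 7 ^ m * f (d k)"
    proof (cases "d k \<le> r")
      \<comment> \<open>A covering ball of radius at most \<open>r\<close> meets at most
        \<open>7 ^ m\<close> grid balls, where 7 = 4 + 3 comes from the count.\<close>
      case True
      then have "4 * d k / r + 3 \<le> 7" using \<open>0 < r\<close> by (simp add: field_simps)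
      then have "(4 * d k / r + 3) ^ m \<le> 7 ^ m"
        using d[of k] \<open>0 < r\<close> by (intro power_mono) auto
      with k have "real (card {z \<in> Z. k \<in> ?H z}) \<le> 7 ^ m" by linarith
      then show ?thesis
        using f_d[of k] f_pos[OF \<open>0 < r\<close>] by (intro mult_mono) (auto simp: w_def)
    next
      case False
      then have "4 * d k / r + 3 \<le> 7 * d k / r" using \<open>0 < r\<close> by (simp add: field_simps)
      then have "(4 * d k / r + 3) ^ m \<le> (7 * d k / r) ^ m"
        using d[of k] \<open>0 < r\<close> by (intro power_mono) auto
      with k have "real (card {z \<in> Z. k \<in> ?H z}) \<le> (7 * d k / r) ^ m" by linarith
      then have "real (card {z \<in> Z. k \<in> ?H z}) * w k \<le> (7 * d k / r) ^ m * f r"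
        using f_d[of k] d[of k] f_pos[OF \<open>0 < r\<close>] \<open>0 < r\<close> by (intro mult_mono) (auto simp: w_def)
      \<comment> \<open>The factor \<open>r ^ m\<close> of \<open>f r\<close> cancels the
        denominator in the count; monotonicity of \<open>g\<close> then restores the cost of the
        covering ball.\<close>
      also have "\<dots> = 7 ^ m * (d k ^ m * g r)"
        using \<open>0 < r\<close> by (simp add: f_eq power_mult_distrib power_divide)
      also have "\<dots> \<le> 7 ^ m * (d k ^ m * g (d k))"
        using False d[of k] \<open>0 < r\<close> by (intro mult_left_mono g_mono) auto
      finally show ?thesis using d[of k] by (simp add: f_eq)
    qed
  qed (use \<open>finite Z\<close> w_sub summ_sub in \<open>auto intro: summable_on_cmult_right\<close>)
  also have "\<dots> = 7 ^ m * infsum (\<lambda>k. f (d k)) ?A"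
    by (rule infsum_cmult_right) (use summ_sub in auto)
  finally show ?thesis by simp
qed

text \<open>Enlargement factor for covering balls: the grid reaches out to
  \<open>C * \<rho>\<close>, and the 2 absorbs the radius of a grid ball and that of the covering
  ball itself.\<close>

definition fat :: real where "fat = C + 2"

text \<open>Chosen to cancel the volume factor \<open>fat ^ DIM('a)\<close> of the enlarged balls
  when \<open>one_step\<close> is iterated.\<close>

definition dens :: real where "dens = (1 / fat) ^ DIM('a)"

lemma dens: "0 < dens" "dens \<le> 1"
  using C_pos by (auto simp: dens_def fat_def intro!: power_le_one)

text \<open>By \<open>none\<close> all balls of one grid near \<open>x\<close> are expensive, and
  their number times \<open>f r\<close> is of order \<open>\<rho> ^ m * g r\<close>, which is the
  volume scale \<open>\<rho> ^ DIM('a)\<close>. Since \<open>x\<close> avoids the enlarged balls,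
  only covering balls of radius below \<open>\<rho>\<close> can pay for them; these are centred near
  \<open>x\<close> and have indices outside \<open>F\<close>.\<close>

lemma ball_cost:
  fixes u :: "'k \<Rightarrow> 'a" and d :: "'k \<Rightarrow> real"
  assumes "x \<in> E" "open U" "x \<in> U" "0 < e"
    and d: "\<And>k. 0 < d k" and summ: "(\<lambda>k. f (d k)) summable_on UNIV"
    and dF: "\<And>k. k \<in> F \<Longrightarrow> e \<le> d k"
    and far: "\<And>k. cball (u k) (d k) \<inter> U \<noteq> {} \<Longrightarrow> fat * d k < dist x (u k)"
    and none: "\<And>z s S. 0 < s \<Longrightarrow> s < e \<Longrightarrow> S \<in> T N \<Longrightarrow> cball z s \<subseteq> U \<inter> S \<Longrightarrow>
        dens * f s \<le> infsum (\<lambda>k. f (d k)) {k. dist z (u k) \<le> d k + s}"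
  shows "\<exists>R>0. R < e \<and>
     measure lebesgue (cball x R) \<le> unit_ball_vol DIM('a) * (C + 3) ^ DIM('a) * 2 ^ m * 7 ^ m / (dens * \<kappa> ^ DIM('a))
       * infsum (\<lambda>k. f (d k)) {k. k \<notin> F \<and> u k \<in> cball x R}"
proof -
  obtain e' where e': "0 < e'" "cball x e' \<subseteq> U"
    using \<open>open U\<close> \<open>x \<in> U\<close> open_contains_cball by blast
  \<comment> \<open>For \<open>\<rho> < e''\<close> the radius \<open>(C + 3) * \<rho>\<close> is
    below \<open>e\<close>, and the ball about \<open>x\<close> of this radius stays in
    \<open>U\<close>.\<close>
  define e'' where "e'' = min e e' / (C + 3)"
  have e'': "0 < e''" "(C + 3) * e'' \<le> e" "(C + 3) * e'' \<le> e'"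
    using e' \<open>0 < e\<close> C_pos by (auto simp: e''_def)
  obtain r \<rho> Z where r: "0 < r" "r \<le> \<rho>" "\<rho> < e''" and \<rho>: "\<rho> ^ DIM('a) = \<rho> ^ m * g r"
    and Z: "finite Z" "(\<rho> / (2 * r)) ^ m \<le> card Z" "Z \<subseteq> cball x (C * \<rho>)"
      "\<And>z. z \<in> Z \<Longrightarrow> \<exists>S\<in>T N. cball z (\<kappa> * r) \<subseteq> S"
    and count: "\<And>u d. 0 \<le> d \<Longrightarrow> card {z \<in> Z. dist z u \<le> d + \<kappa> * r} \<le> (4 * d / r + 3) ^ m"
    using grid[OF \<open>x \<in> E\<close> e''(1), of N] by blast
  have \<rho>0: "0 < \<rho>" using r by linarith
  have C\<rho>: "(C + 3) * \<rho> < (C + 3) * e''" using r C_pos by simp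
  have "\<kappa> * r \<le> 1 * r" using \<kappa> r by (intro mult_right_mono) auto
  then have "\<kappa> * r \<le> \<rho>" using r by linarith
  moreover have "0 < \<kappa> * r" using \<kappa> r by simp
  ultimately have \<kappa>r: "0 < \<kappa> * r" "\<kappa> * r \<le> \<rho>" by auto
  have Ze: "\<rho> < e"
  proof -
    have "\<rho> * 1 \<le> \<rho> * (C + 3)" using C_pos \<rho>0 by (intro mult_left_mono) auto
    with C\<rho> e'' show ?thesis by (simp add: mult.commute)
  qed
  have in_U: "cball z (\<kappa> * r) \<subseteq> U" if "z \<in> Z" for z
  proof -
    have "dist x z \<le> C * \<rho>" using Z that by auto
    moreover have "C * \<rho> + \<rho> \<le> e'" using C\<rho> e'' \<rho>0 by (simp add: algebra_simps)
    ultimately have "cball z (\<kappa> * r) \<subseteq> cball x e'"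
      using \<kappa>r by (intro subsetI) (smt (verit, best) dist_triangle mem_cball)
    with e' show ?thesis by blast
  qed
  have near: "k \<notin> F \<and> u k \<in> cball x ((C + 3) * \<rho>)" if "z \<in> Z" "dist z (u k) \<le> d k + \<kappa> * r" for z k
  proof -
    have "cball (u k) (d k) \<inter> cball z (\<kappa> * r) \<noteq> {}"
      using cballs_meet[of "\<kappa> * r" "d k" z "u k"] that(2) d[of k] \<kappa>r by (simp add: Int_commute)
    with in_U[OF that(1)] have "fat * d k < dist x (u k)"
      by (intro far) blast
    moreover have "dist x z \<le> C * \<rho>" using Z that by auto
    ultimately have 1: "fat * d k < C * \<rho> + d k + \<kappa> * r" "dist x (u k) \<le> C * \<rho> + d k + \<kappa> * r"
      using that(2) dist_triangle[of x "u k" z] by linarith+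
    \<comment> \<open>Otherwise the right side of the first inequality in \<open>1\<close> would be
      at most \<open>(C + 2) * d k\<close>, which is \<open>fat * d k\<close>.\<close>
    have "d k < \<rho>"
    proof (rule ccontr)
      assume "\<not> d k < \<rho>"
      then have "C * \<rho> \<le> C * d k" using C_pos by simp
      moreover have "\<kappa> * r \<le> d k" using \<kappa>r \<open>\<not> d k < \<rho>\<close> by linarith
      ultimately show False using 1 by (simp add: fat_def algebra_simps)
    qed
    with 1 \<kappa>r have "dist x (u k) \<le> (C + 3) * \<rho>" by (simp add: algebra_simps)
    moreover have "k \<notin> F" using dF[of k] \<open>d k < \<rho>\<close> Ze by auto
    ultimately show ?thesis by simp
  qed
  have fd: "0 < f (d k)" for k using f_pos d by blast
  define I where "I = infsum (\<lambda>k. f (d k)) {k. k \<notin> F \<and> u k \<in> cball x ((C + 3) * \<rho>)}"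
  have "card Z * (dens * f (\<kappa> * r)) \<le> 7 ^ m * infsum (\<lambda>k. f (d k)) {k. \<exists>z\<in>Z. dist z (u k) \<le> d k + \<kappa> * r}"
  proof (rule grid_cost[OF Z(1) r(1) count d summ dens])
    fix z assume z: "z \<in> Z"
    then obtain S where "S \<in> T N" "cball z (\<kappa> * r) \<subseteq> S" using Z by blast
    then show "dens * f (\<kappa> * r) \<le> infsum (\<lambda>k. f (d k)) {k. dist z (u k) \<le> d k + \<kappa> * r}"
      using in_U[OF z] \<kappa>r Ze by (intro none[of _ S]) auto
  qed
  also have "\<dots> \<le> 7 ^ m * I"
    unfolding I_def
    by (intro mult_left_mono infsum_mono2 summable_on_subset_banach[OF summ])
      (use near fd in \<open>auto intro: less_imp_le\<close>)
  finally have 1: "card Z * (dens * f (\<kappa> * r)) \<le> 7 ^ m * I" .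
  \<comment> \<open>Passing from radius \<open>r\<close> to \<open>\<kappa> * r\<close> lowers
    \<open>f\<close> at most by the factor \<open>\<kappa> ^ DIM('a)\<close>.\<close>
  have "f r * (\<kappa> * r) ^ DIM('a) \<le> f (\<kappa> * r) * r ^ DIM('a)"
    using \<kappa> r by (intro f_quot) (auto simp: mult_le_cancel_right1)
  then have "f r * \<kappa> ^ DIM('a) \<le> f (\<kappa> * r)"
    using r by (simp add: power_mult_distrib)
  then have "(\<rho> / (2 * r)) ^ m * (dens * (f r * \<kappa> ^ DIM('a))) \<le> card Z * (dens * f (\<kappa> * r))"
    using Z(2) dens \<rho>0 r \<kappa> f_pos[OF r(1)] by (intro mult_mono) auto
  also note 1
  \<comment> \<open>The relation between \<open>\<rho>\<close> and \<open>r\<close> enters here: the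
    powers of \<open>r\<close> cancel and leave \<open>\<rho> ^ m * g r\<close>, which is
    \<open>\<rho> ^ DIM('a)\<close>.\<close>
  also have "(\<rho> / (2 * r)) ^ m * (dens * (f r * \<kappa> ^ DIM('a))) = \<rho> ^ DIM('a) * (dens * \<kappa> ^ DIM('a)) / 2 ^ m"
    using r by (simp add: f_eq \<rho> power_divide power_mult_distrib)
  finally have 2: "\<rho> ^ DIM('a) \<le> 2 ^ m * 7 ^ m / (dens * \<kappa> ^ DIM('a)) * I"
    using dens \<kappa> by (simp add: field_simps)
  have "measure lebesgue (cball x ((C + 3) * \<rho>)) = unit_ball_vol DIM('a) * (C + 3) ^ DIM('a) * \<rho> ^ DIM('a)"
    using C_pos \<rho>0 by (simp add: content_cball power_mult_distrib)
  also have "\<dots> \<le> unit_ball_vol DIM('a) * (C + 3) ^ DIM('a) * (2 ^ m * 7 ^ m / (dens * \<kappa> ^ DIM('a)) * I)"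
    using 2 C_pos by (intro mult_left_mono) auto
  finally have 3: "measure lebesgue (cball x ((C + 3) * \<rho>)) \<le>
      unit_ball_vol DIM('a) * (C + 3) ^ DIM('a) * 2 ^ m * 7 ^ m / (dens * \<kappa> ^ DIM('a)) * I"
    by (simp add: mult_ac)
  have "0 < (C + 3) * \<rho>" using \<rho>0 C_pos by simp
  moreover have "(C + 3) * \<rho> < e" using C\<rho> e''(2) by linarith
  moreover note 3
  ultimately show ?thesis unfolding I_def by blast
qed

end

lemma measure_le_of_negligible_diff:
  assumes "S \<in> lmeasurable" "T \<in> lmeasurable" "negligible (S - T)"
  shows "measure lebesgue S \<le> measure lebesgue T"
proof -
  have "S - T \<in> lmeasurable" "measure lebesgue (S - T) = 0"
    using assms(3) by (simp_all add: negligible_imp_measurable negligible_imp_measure0)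
  then show ?thesis
    using measure_diff_le_measure_setdiff[OF assms(1,2)] by simp
qed

context grid_system
begin

text \<open>
  If the claim failed, \<open>ball_cost\<close> would bound the part of \<open>U\<close> outside the enlarged covering balls by a
  constant times the tail of a convergent series, so the enlarged balls would exhaust \<open>U\<close> up to a null
  set, against the volume bound.
\<close>

lemma one_step:
  fixes u :: "'k::countable \<Rightarrow> 'a" and d :: "'k \<Rightarrow> real"
  assumes "open U" "U \<in> lmeasurable" "negligible (U - E)" "0 < e"
    and d: "\<And>k. 0 < d k" and summ: "(\<lambda>k. f (d k)) summable_on UNIV"
    and b: "\<And>k. cball (u k) (d k) \<inter> U \<noteq> {} \<Longrightarrow> d k ^ DIM('a) \<le> b * f (d k)" "0 \<le> b"
    and less: "unit_ball_vol DIM('a) * fat ^ DIM('a) * b *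
        infsum (\<lambda>k. f (d k)) {k. cball (u k) (d k) \<inter> U \<noteq> {}} < measure lebesgue U"
  shows "\<exists>z s. \<exists>S\<in>T N. 0 < s \<and> s < e \<and> cball z s \<subseteq> U \<inter> S \<and>
    infsum (\<lambda>k. f (d k)) {k. dist z (u k) \<le> d k + s} < dens * f s"
proof (rule ccontr)
  assume "\<not> ?thesis"
  then have none: "dens * f s \<le> infsum (\<lambda>k. f (d k)) {k. dist z (u k) \<le> d k + s}"
    if "0 < s" "s < e" "S \<in> T N" "cball z s \<subseteq> U \<inter> S" for z s S
    using that not_less by blast
  define H where "H = {k. cball (u k) (d k) \<inter> U \<noteq> {}}"
  define V where "V = (\<Union>k\<in>H. cball (u k) (fat * d k))"
  have fat0: "0 < fat" using C_pos by (simp add: fat_def)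
  have fd: "0 \<le> f (d k)" for k using f_pos d by (simp add: less_imp_le)
  have summ_sub: "(\<lambda>k. f (d k)) summable_on B" for B
    using summable_on_subset_banach[OF summ] by blast
  \<comment> \<open>Hypothesis \<open>b\<close> trades volume for cost; the resulting bound for
    \<open>V\<close> is the left side of \<open>less\<close>.\<close>
  have V_bound: "measure lebesgue (\<Union>k\<in>F. cball (u k) (fat * d k)) \<le>
      unit_ball_vol DIM('a) * fat ^ DIM('a) * b * infsum (\<lambda>k. f (d k)) H" if "F \<subseteq> H" "finite F" for F
  proof -
    have "measure lebesgue (\<Union>k\<in>F. cball (u k) (fat * d k)) \<le> (\<Sum>k\<in>F. measure lebesgue (cball (u k) (fat * d k)))"
      by (rule measure_UNION_le[OF that(2)]) auto
    also have "\<dots> = (\<Sum>k\<in>F. unit_ball_vol DIM('a) * fat ^ DIM('a) * d k ^ DIM('a))"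
      using d fat0 by (simp add: content_cball power_mult_distrib less_imp_le mult.assoc)
    also have "\<dots> \<le> (\<Sum>k\<in>F. unit_ball_vol DIM('a) * fat ^ DIM('a) * (b * f (d k)))"
    proof (intro sum_mono mult_left_mono)
      show "d k ^ DIM('a) \<le> b * f (d k)" if "k \<in> F" for k
        using that \<open>F \<subseteq> H\<close> b(1)[of k] by (auto simp: H_def)
    qed (use fat0 in auto)
    also have "\<dots> = unit_ball_vol DIM('a) * fat ^ DIM('a) * b * (\<Sum>k\<in>F. f (d k))"
      by (simp add: sum_distrib_left mult.assoc)
    also have "\<dots> \<le> unit_ball_vol DIM('a) * fat ^ DIM('a) * b * infsum (\<lambda>k. f (d k)) H"
      using that fat0 fd b(2) by (intro mult_left_mono finite_sum_le_infsum summ_sub) auto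
    finally show ?thesis .
  qed
  have V: "V \<in> lmeasurable"
    "measure lebesgue V \<le> unit_ball_vol DIM('a) * fat ^ DIM('a) * b * infsum (\<lambda>k. f (d k)) H"
    unfolding V_def
    using fmeasurable_UN_bound[OF _ _ V_bound, of H] measure_UN_bound[OF _ _ V_bound, of H]
    by simp_all
  \<comment> \<open>The points off the enlarged balls at which \<open>ball_cost\<close>
    applies.\<close>
  define W where "W = (U \<inter> E) - V"
  define K where "K = unit_ball_vol DIM('a) * (C + 3) ^ DIM('a) * 2 ^ m * 7 ^ m / (dens * \<kappa> ^ DIM('a))"
  have K: "0 < K" using C_pos dens \<kappa> by (auto simp: K_def)
  \<comment> \<open>Here \<open>\<eta>\<close> bounds a tail of the cost series, and almost all of
    \<open>W\<close> is covered by a set of measure at most \<open>K * \<eta>\<close>.\<close>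
  have bound: "measure lebesgue U \<le> measure lebesgue V + K * \<eta>" if "0 < \<eta>" for \<eta>
  proof -
    obtain F where "F \<subseteq> UNIV" and F: "finite F" "\<And>B. B \<subseteq> UNIV - F \<Longrightarrow> infsum (\<lambda>k. f (d k)) B \<le> \<eta>"
      by (rule infsum_small_outside_finite[OF summ fd \<open>0 < \<eta>\<close>]) blast
    \<comment> \<open>Below \<open>eF\<close>, \<open>ball_cost\<close> ignores the finitely many
      covering balls indexed by \<open>F\<close> and charges only the tail.\<close>
    define eF where "eF = Min (insert e (d ` F))"
    have eF: "0 < eF" "eF \<le> e" "\<And>k. k \<in> F \<Longrightarrow> eF \<le> d k"
      using F(1) d \<open>0 < e\<close> by (auto simp: eF_def)
    define A where "A x r = {k. k \<notin> F \<and> u k \<in> cball x r}" for x r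
    define P where "P x r \<longleftrightarrow> measure lebesgue (cball x r) \<le> K * infsum (\<lambda>k. f (d k)) (A x r)" for x r
    obtain R where R: "R \<in> lmeasurable" "measure lebesgue R \<le> K * \<eta>" "negligible (W - R)"
    proof (rule Vitali_measure_bound[of W P "K * \<eta>"])
      fix e' :: real and x :: 'a
      assume x: "x \<in> W" and "0 < e'"
      have "\<exists>R>0. R < min e' eF \<and> P x R"
        unfolding P_def K_def A_def
      proof (rule ball_cost[where U=U and N=N])
        show "fat * d k < dist x (u k)" if "cball (u k) (d k) \<inter> U \<noteq> {}" for k
          using that x by (auto simp: W_def V_def H_def dist_commute not_le)
        show "min e' eF \<le> d k" if "k \<in> F" for k using eF(3)[OF that] by simp
        show "dens * f s \<le> infsum (\<lambda>k. f (d k)) {k. dist z (u k) \<le> d k + s}"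
          if "0 < s" "s < min e' eF" "S \<in> T N" "cball z s \<subseteq> U \<inter> S" for z s S
          using none that eF(2) by (meson less_le_trans min.cobounded2)
      qed (use x \<open>open U\<close> \<open>0 < e'\<close> eF d summ in \<open>auto simp: W_def\<close>)
      then show "\<exists>R>0. R < e' \<and> P x R" by auto
    next
      fix G :: "('a \<times> real) set"
      assume G: "finite G" "\<And>x r. (x, r) \<in> G \<Longrightarrow> 0 < r \<and> P x r"
        "pairwise (\<lambda>(x, r) (x', r'). disjnt (cball x r) (cball x' r')) G"
      have "(\<Sum>(x, r)\<in>G. measure lebesgue (cball x r)) \<le> (\<Sum>(x, r)\<in>G. K * infsum (\<lambda>k. f (d k)) (A x r))"
        using G(2) by (intro sum_mono) (auto simp: P_def)
      also have "\<dots> = K * (\<Sum>p\<in>G. infsum (\<lambda>k. f (d k)) (A (fst p) (snd p)))"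
        by (simp add: sum_distrib_left case_prod_unfold)
      also have "(\<Sum>p\<in>G. infsum (\<lambda>k. f (d k)) (A (fst p) (snd p))) \<le> infsum (\<lambda>k. f (d k)) (UNIV - F)"
      proof (rule sum_infsum_le_infsum[OF G(1) summ_sub summ_sub])
        fix k
        \<comment> \<open>The balls in \<open>G\<close> are disjoint, so a centre \<open>u k\<close>
          lies in at most one of them.\<close>
        have "p = q" if "p \<in> G" "q \<in> G" "k \<in> A (fst p) (snd p)" "k \<in> A (fst q) (snd q)" for p q
          using pairwiseD[OF G(3) that(1,2)] that(3,4)
          unfolding disjnt_def case_prod_unfold A_def by blast
        then have "card {p \<in> G. k \<in> A (fst p) (snd p)} \<le> 1"
          using G(1) by (simp add: card_le_Suc0_iff_eq)
        then have "real (card {p \<in> G. k \<in> A (fst p) (snd p)}) * f (d k) \<le> 1 * f (d k)"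
          using fd by (intro mult_right_mono) auto
        then show "real (card {p \<in> G. k \<in> A (fst p) (snd p)}) * f (d k) \<le> f (d k)" by simp
      qed (auto simp: A_def)
      also have "\<dots> \<le> \<eta>" by (rule F(2)) simp
      finally show "(\<Sum>(x, r)\<in>G. measure lebesgue (cball x r)) \<le> K * \<eta>" using K by simp
    qed
    have "negligible (U - (V \<union> R))"
      by (rule negligible_subset[OF negligible_Un[OF assms(3) R(3)]]) (auto simp: W_def)
    then have "measure lebesgue U \<le> measure lebesgue (V \<union> R)"
      by (intro measure_le_of_negligible_diff) (use assms V R in auto)
    also have "\<dots> \<le> measure lebesgue V + measure lebesgue R"
      using V R by (intro measure_Un_le) auto
    finally show ?thesis using R by linarith
  qed
  have "measure lebesgue U \<le> measure lebesgue V"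
  proof (rule field_le_epsilon)
    fix \<epsilon> :: real assume "0 < \<epsilon>"
    then show "measure lebesgue U \<le> measure lebesgue V + \<epsilon>"
      using bound[of "\<epsilon> / K"] K by simp
  qed
  with V less show False by (simp add: H_def)
qed

text \<open>
  The bound \<open>dens * f s\<close> obtained in \<open>one_step\<close> forces \<open>d k < s\<close> for all covering balls meeting the
  small ball, so that the monotonicity of \<open>f r / r ^ DIM('a)\<close> turns it back into the volume hypothesis
  of \<open>one_step\<close> and the step can be iterated.
\<close>

lemma limsup_not_covered:
  fixes u :: "'k::countable \<Rightarrow> 'a" and d :: "'k \<Rightarrow> real"
  assumes f_lim: "(f \<longlongrightarrow> 0) (at_right 0)"
    and U: "open U" "U \<in> lmeasurable" "negligible (U - E)"
    and d: "\<And>k. 0 < d k" and summ: "(\<lambda>k. f (d k)) summable_on UNIV"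
    and b: "\<And>k. d k ^ DIM('a) \<le> b * f (d k)" "0 \<le> b"
    and less: "unit_ball_vol DIM('a) * fat ^ DIM('a) * b * infsum (\<lambda>k. f (d k)) UNIV < measure lebesgue U"
  shows "\<exists>x\<in>U. (\<forall>N. \<exists>S\<in>T N. x \<in> S) \<and> x \<notin> (\<Union>k. cball (u k) (d k))"
proof -
  \<comment> \<open>The cost bound lets the construction continue inside the chosen ball; the bound
    on the radius makes the nested balls shrink to a point.\<close>
  define good where "good n p \<longleftrightarrow> 0 < snd p \<and> snd p < 1 / real (Suc n) \<and> cball (fst p) (snd p) \<subseteq> U \<and>
     (\<exists>S\<in>T n. cball (fst p) (snd p) \<subseteq> S) \<and>
     infsum (\<lambda>k. f (d k)) {k. dist (fst p) (u k) \<le> d k + snd p} < dens * f (snd p)"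
    for n :: nat and p :: "'a \<times> real"
  have fat0: "0 < fat" using C_pos by (simp add: fat_def)
  have fd: "0 \<le> f (d k)" for k using f_pos d by (simp add: less_imp_le)
  have summ_sub: "(\<lambda>k. f (d k)) summable_on B" for B
    using summable_on_subset_banach[OF summ] by blast
  have start: "\<exists>p. good 0 p"
  proof -
    have "infsum (\<lambda>k. f (d k)) {k. cball (u k) (d k) \<inter> U \<noteq> {}} \<le> infsum (\<lambda>k. f (d k)) UNIV"
      using fd by (intro infsum_mono2 summ_sub) auto
    then have "unit_ball_vol DIM('a) * fat ^ DIM('a) * b * infsum (\<lambda>k. f (d k)) {k. cball (u k) (d k) \<inter> U \<noteq> {}}
        \<le> unit_ball_vol DIM('a) * fat ^ DIM('a) * b * infsum (\<lambda>k. f (d k)) UNIV"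
      using fat0 b by (intro mult_left_mono) auto
    with less have *: "unit_ball_vol DIM('a) * fat ^ DIM('a) * b *
        infsum (\<lambda>k. f (d k)) {k. cball (u k) (d k) \<inter> U \<noteq> {}} < measure lebesgue U" by linarith
    have "\<exists>z s. \<exists>S\<in>T 0. 0 < s \<and> s < 1 \<and> cball z s \<subseteq> U \<inter> S \<and>
        infsum (\<lambda>k. f (d k)) {k. dist z (u k) \<le> d k + s} < dens * f s"
      by (rule one_step[OF U _ d summ b *]) auto
    then show ?thesis by (auto simp: good_def)
  qed
  have step: "\<exists>q. good (Suc n) q \<and> cball (fst q) (snd q) \<subseteq> cball (fst p) (snd p)" if p: "good n p" for n p
  proof -
    obtain z s where zs: "p = (z, s)" by force
    have s: "0 < s" "cball z s \<subseteq> U" "infsum (\<lambda>k. f (d k)) {k. dist z (u k) \<le> d k + s} < dens * f s"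
      using p by (auto simp: good_def zs)
    have fs: "0 < f s" using f_pos s by blast
    have hit: "dist z (u k) \<le> d k + s" if "cball (u k) (d k) \<inter> ball z s \<noteq> {}" for k
    proof -
      obtain v where "v \<in> cball (u k) (d k)" "v \<in> ball z s" using \<open>cball (u k) (d k) \<inter> ball z s \<noteq> {}\<close> by blast
      then show ?thesis using dist_triangle[of z "u k" v] by (simp add: dist_commute)
    qed
    have "\<exists>w t. \<exists>S\<in>T (Suc n). 0 < t \<and> t < 1 / real (Suc (Suc n)) \<and> cball w t \<subseteq> ball z s \<inter> S \<and>
        infsum (\<lambda>k. f (d k)) {k. dist w (u k) \<le> d k + t} < dens * f t"
    \<comment> \<open>The ratio of volume scale to cost at radius \<open>s\<close>; by
      \<open>f_quot\<close> it dominates the same ratio at every smaller radius.\<close>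
    proof (rule one_step[where b="s ^ DIM('a) / f s"])
      show "negligible (ball z s - E)"
        by (rule negligible_subset[OF U(3)]) (use s in auto)
      show "d k ^ DIM('a) \<le> s ^ DIM('a) / f s * f (d k)" if k: "cball (u k) (d k) \<inter> ball z s \<noteq> {}" for k
      proof -
        have "f (d k) = sum (\<lambda>k. f (d k)) {k}" by simp
        also have "\<dots> \<le> infsum (\<lambda>k. f (d k)) {k. dist z (u k) \<le> d k + s}"
          using fd hit[OF k] by (intro finite_sum_le_infsum summ_sub) auto
        also have "\<dots> < dens * f s" by (rule s(3))
        also have "\<dots> \<le> f s" using dens fs by simp
        finally have "d k < s" using f_mono[of s "d k"] s by force
        then have "f s * d k ^ DIM('a) \<le> f (d k) * s ^ DIM('a)"
          using d by (intro f_quot) auto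
        then show ?thesis using fs by (simp add: field_simps)
      qed
      have "infsum (\<lambda>k. f (d k)) {k. cball (u k) (d k) \<inter> ball z s \<noteq> {}} \<le>
          infsum (\<lambda>k. f (d k)) {k. dist z (u k) \<le> d k + s}"
        using fd hit by (intro infsum_mono2 summ_sub) auto
      also have "\<dots> < dens * f s" by (rule s(3))
      finally have "unit_ball_vol DIM('a) * fat ^ DIM('a) * (s ^ DIM('a) / f s) *
        infsum (\<lambda>k. f (d k)) {k. cball (u k) (d k) \<inter> ball z s \<noteq> {}} <
         unit_ball_vol DIM('a) * fat ^ DIM('a) * (s ^ DIM('a) / f s) * (dens * f s)"
        using fat0 s fs by (intro mult_strict_left_mono) auto
      \<comment> \<open>The factor \<open>fat ^ DIM('a)\<close> cancels against \<open>dens\<close>,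
        leaving exactly the volume of the ball.\<close>
      also have "\<dots> = unit_ball_vol DIM('a) * s ^ DIM('a)"
        using fat0 fs by (simp add: dens_def power_divide)
      also have "\<dots> = measure lebesgue (ball z s)"
        using s by (simp add: content_ball)
      finally show "unit_ball_vol DIM('a) * fat ^ DIM('a) * (s ^ DIM('a) / f s) *
        infsum (\<lambda>k. f (d k)) {k. cball (u k) (d k) \<inter> ball z s \<noteq> {}} < measure lebesgue (ball z s)" .
    qed (use s fs d summ in auto)
    then obtain w t S where wt: "S \<in> T (Suc n)" "0 < t" "t < 1 / real (Suc (Suc n))" "cball w t \<subseteq> ball z s \<inter> S"
        "infsum (\<lambda>k. f (d k)) {k. dist w (u k) \<le> d k + t} < dens * f t" by blast
    have "good (Suc n) (w, t) \<and> cball w t \<subseteq> cball z s"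
      unfolding good_def fst_conv snd_conv using wt s(2) ball_subset_cball[of z s] by blast
    then show ?thesis unfolding zs by (intro exI[of _ "(w, t)"]) simp
  qed
  obtain p where p: "\<And>n. good n (p n)" "\<And>n. cball (fst (p (Suc n))) (snd (p (Suc n))) \<subseteq> cball (fst (p n)) (snd (p n))"
    using dependent_nat_choice[of good "\<lambda>n p q. cball (fst q) (snd q) \<subseteq> cball (fst p) (snd p)", OF start step] by blast
  have "(\<Inter>n. cball (fst (p n)) (snd (p n))) \<noteq> {}"
  proof (rule compact_nest)
    show "cball (fst (p n)) (snd (p n)) \<noteq> {}" for n using p(1)[of n] by (simp add: good_def)
    show "cball (fst (p n)) (snd (p n)) \<subseteq> cball (fst (p m)) (snd (p m))" if "m \<le> n" for m n
      using that by (rule lift_Suc_antimono_le[rotated]) (rule p(2))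
  qed auto
  then obtain x where x: "\<And>n. x \<in> cball (fst (p n)) (snd (p n))" by blast
  have "x \<notin> cball (u k) (d k)" for k
  proof
    assume k: "x \<in> cball (u k) (d k)"
    \<comment> \<open>A covering ball containing the limit point hits every nested ball, so its cost
      is at most the value of \<open>f\<close> at radii tending to zero, against positivity.\<close>
    have le: "f (d k) \<le> f (snd (p n))" for n
    proof -
      have hit: "dist (fst (p n)) (u k) \<le> d k + snd (p n)"
        using k x[of n] dist_triangle[of "fst (p n)" "u k" x] by (simp add: dist_commute)
      have "f (d k) = sum (\<lambda>k. f (d k)) {k}" by simp
      also have "\<dots> \<le> infsum (\<lambda>k. f (d k)) {k. dist (fst (p n)) (u k) \<le> d k + snd (p n)}"
        using fd hit by (intro finite_sum_le_infsum summ_sub) auto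
      also have "\<dots> < dens * f (snd (p n))" using p(1)[of n] by (simp add: good_def)
      also have "\<dots> \<le> f (snd (p n))" using dens f_pos[of "snd (p n)"] p(1)[of n] by (simp add: good_def)
      finally show ?thesis by simp
    qed
    have "(\<lambda>n. snd (p n)) \<longlonglongrightarrow> 0"
      by (rule tendsto_sandwich[OF _ _ tendsto_const LIMSEQ_Suc[OF lim_inverse_n']])
        (use p(1) in \<open>auto simp: good_def intro!: always_eventually less_imp_le\<close>)
    then have "filterlim (\<lambda>n. snd (p n)) (at_right 0) sequentially"
      by (rule tendsto_imp_filterlim_at_right) (use p(1) in \<open>auto simp: good_def\<close>)
    from filterlim_compose[OF f_lim this] have "(\<lambda>n. f (snd (p n))) \<longlonglongrightarrow> 0" .
    then have "f (d k) \<le> 0"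
      by (rule LIMSEQ_le_const) (use le in auto)
    with f_pos[OF d[of k]] show False by simp
  qed
  moreover have "x \<in> U" using p(1)[of 0] x[of 0] by (auto simp: good_def)
  moreover have "\<exists>S\<in>T N. x \<in> S" for N using p(1)[of N] x[of N] by (auto simp: good_def)
  ultimately show ?thesis by blast
qed

end

subsection \<open>Hausdorff measures\<close>

lemma hausdorff_premeasure_mono:
  "X \<subseteq> Y \<Longrightarrow> hausdorff_premeasure f \<delta> X \<le> hausdorff_premeasure f \<delta> Y"
  unfolding hausdorff_premeasure_def by (rule Inf_superset_mono) blast

lemma hausdorff_measure_mono:
  "X \<subseteq> Y \<Longrightarrow> hausdorff_measure f X \<le> hausdorff_measure f Y"
  unfolding hausdorff_measure_def by (intro SUP_mono) (use hausdorff_premeasure_mono in blast)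

lemma hausdorff_premeasure_le_measure:
  "0 < \<delta> \<Longrightarrow> hausdorff_premeasure f \<delta> X \<le> hausdorff_measure f X"
  unfolding hausdorff_measure_def by (rule SUP_upper) simp

text \<open>Allows covers over any countable index set, with cost controlled through finite sums.
  The cover is transported along an enumeration and padded with empty sets, which cost
  nothing.\<close>

lemma hausdorff_premeasure_le:
  assumes "countable I" "X \<subseteq> (\<Union>i\<in>I. U i)" "0 \<le> \<delta>"
    and U: "\<And>i. i \<in> I \<Longrightarrow> bounded (U i) \<and> diameter (U i) \<le> \<delta>"
    and bound: "\<And>F. finite F \<Longrightarrow> F \<subseteq> I \<Longrightarrow> (\<Sum>i\<in>F. gauge_cost f (U i)) \<le> B"
  shows "hausdorff_premeasure f \<delta> X \<le> B"
proof -
  define J where "J = to_nat_on I ` I"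
  define W where "W n = (if n \<in> J then U (from_nat_into I n) else {})" for n
  have inj: "inj_on (from_nat_into I) J"
    using \<open>countable I\<close> by (auto simp: J_def inj_on_def)
  have in_I: "from_nat_into I n \<in> I" if "n \<in> J" for n
    using that \<open>countable I\<close> by (auto simp: J_def)
  have "X \<subseteq> (\<Union>n. W n)"
  proof
    fix x assume "x \<in> X"
    then obtain i where i: "i \<in> I" "x \<in> U i" using assms(2) by blast
    then have "x \<in> W (to_nat_on I i)"
      using \<open>countable I\<close> by (auto simp: W_def J_def)
    then show "x \<in> (\<Union>n. W n)" by blast
  qed
  moreover have "bounded (W n) \<and> diameter (W n) \<le> \<delta>" for n
    using U[OF in_I, of n] \<open>0 \<le> \<delta>\<close> by (auto simp: W_def)
  ultimately have "hausdorff_premeasure f \<delta> X \<le> (\<Sum>n. gauge_cost f (W n))"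
    unfolding hausdorff_premeasure_def by (intro Inf_lower) blast
  also have "\<dots> \<le> B"
  proof (rule suminf_le_const)
    fix N :: nat
    have "(\<Sum>n<N. gauge_cost f (W n)) = (\<Sum>n\<in>{..<N} \<inter> J. gauge_cost f (U (from_nat_into I n)))"
      by (rule sum.mono_neutral_cong_right) (auto simp: W_def gauge_cost_def)
    also have "\<dots> = (\<Sum>i\<in>from_nat_into I ` ({..<N} \<inter> J). gauge_cost f (U i))"
      by (rule sum.reindex_cong[symmetric, of "from_nat_into I"])
        (use inj in \<open>auto intro: inj_on_subset\<close>)
    also have "\<dots> \<le> B"
      using in_I by (intro bound) auto
    finally show "(\<Sum>n<N. gauge_cost f (W n)) \<le> B" .
  qed simp
  finally show ?thesis .
qed

lemma hausdorff_premeasure_cover: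
  assumes "hausdorff_premeasure f \<delta> X < t"
  obtains U :: "nat \<Rightarrow> 'a::metric_space set" where "X \<subseteq> (\<Union>i. U i)"
    "\<And>i. bounded (U i) \<and> diameter (U i) \<le> \<delta>" "(\<Sum>i. gauge_cost f (U i)) < t"
  using assms unfolding hausdorff_premeasure_def Inf_less_iff by blast

text \<open>Covers of the two sets, each within \<open>e / 2\<close> of optimal, are joined over the
  index type \<open>nat + nat\<close>.\<close>

lemma hausdorff_premeasure_Un:
  assumes "0 \<le> \<delta>"
  shows "hausdorff_premeasure f \<delta> (X \<union> Y) \<le> hausdorff_premeasure f \<delta> X + hausdorff_premeasure f \<delta> Y"
proof (rule ennreal_le_epsilon)
  fix e :: real
  let ?h = "hausdorff_premeasure f \<delta>"
  assume fin: "?h X + ?h Y < top" and "0 < e"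
  have less: "x < x + ennreal (e / 2)" if "x < top" for x :: ennreal
    using that \<open>0 < e\<close> by (cases x) (auto simp: ennreal_less_iff simp flip: ennreal_plus)
  have "?h X < ?h X + ennreal (e / 2)" "?h Y < ?h Y + ennreal (e / 2)"
    using less[of "?h X"] less[of "?h Y"] fin by (auto simp: ennreal_add_eq_top less_top)
  then obtain U V where U: "X \<subseteq> (\<Union>i. U i)" "\<And>i. bounded (U i) \<and> diameter (U i) \<le> \<delta>"
      "(\<Sum>i. gauge_cost f (U i)) < ?h X + ennreal (e / 2)"
    and V: "Y \<subseteq> (\<Union>i. V i)" "\<And>i. bounded (V i) \<and> diameter (V i) \<le> \<delta>"
      "(\<Sum>i. gauge_cost f (V i)) < ?h Y + ennreal (e / 2)"
    using hausdorff_premeasure_cover[of f \<delta>] by metis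
  have "?h (X \<union> Y) \<le> (?h X + ennreal (e / 2)) + (?h Y + ennreal (e / 2))"
  proof (rule hausdorff_premeasure_le[where I=UNIV and U="case_sum U V"])
    show "X \<union> Y \<subseteq> (\<Union>i. case_sum U V i)"
    proof
      fix x assume "x \<in> X \<union> Y"
      then obtain i where "x \<in> U i \<or> x \<in> V i" using U(1) V(1) by blast
      then have "x \<in> case_sum U V (Inl i) \<or> x \<in> case_sum U V (Inr i)" by simp
      then show "x \<in> (\<Union>i. case_sum U V i)" by blast
    qed
    show "bounded (case_sum U V i) \<and> diameter (case_sum U V i) \<le> \<delta>" for i
      using U(2) V(2) by (cases i) auto
    fix F :: "(nat + nat) set" assume "finite F"
    then have fin: "finite (Inl -` F)" "finite (Inr -` F)"
      by (auto intro: finite_vimageI)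
    have "F = (Inl -` F) <+> (Inr -` F)"
    proof (rule set_eqI)
      fix x show "x \<in> F \<longleftrightarrow> x \<in> (Inl -` F) <+> (Inr -` F)" by (cases x) auto
    qed
    then have "(\<Sum>i\<in>F. gauge_cost f (case_sum U V i)) =
        (\<Sum>i\<in>Inl -` F. gauge_cost f (U i)) + (\<Sum>i\<in>Inr -` F. gauge_cost f (V i))"
      using sum.Plus[OF fin, of "\<lambda>i. gauge_cost f (case_sum U V i)"] by (simp add: comp_def)
    also have "\<dots> \<le> (\<Sum>i. gauge_cost f (U i)) + (\<Sum>i. gauge_cost f (V i))"
      using fin by (intro add_mono sum_le_suminf) auto
    also have "\<dots> \<le> (?h X + ennreal (e / 2)) + (?h Y + ennreal (e / 2))"
      using U(3) V(3) by (intro add_mono less_imp_le)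
    finally show "(\<Sum>i\<in>F. gauge_cost f (case_sum U V i)) \<le> (?h X + ennreal (e / 2)) + (?h Y + ennreal (e / 2))" .
  qed (use assms in auto)
  also have "\<dots> = ?h X + ?h Y + (ennreal (e / 2) + ennreal (e / 2))"
    by (simp add: ac_simps)
  also have "ennreal (e / 2) + ennreal (e / 2) = ennreal e"
    using \<open>0 < e\<close> by (simp flip: ennreal_plus)
  finally show "?h (X \<union> Y) \<le> ?h X + ?h Y + ennreal e" .
qed

text \<open>Finite subadditivity at each fixed scale is enough; no measurability enters.\<close>

lemma hausdorff_measure_eq_of_null_diff:
  assumes "X \<subseteq> Y" "hausdorff_measure f (Y - X) = 0"
  shows "hausdorff_measure f X = hausdorff_measure f Y"
proof (rule antisym)
  show "hausdorff_measure f Y \<le> hausdorff_measure f X"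
    unfolding hausdorff_measure_def[of f Y]
  proof (rule SUP_least)
    fix \<delta> :: real assume "\<delta> \<in> {0<..}"
    then have "0 < \<delta>" by simp
    have "hausdorff_premeasure f \<delta> (Y - X) = 0"
      using hausdorff_premeasure_le_measure[OF \<open>0 < \<delta>\<close>, of f "Y - X"] assms(2) by simp
    moreover have "Y = X \<union> (Y - X)" using assms(1) by blast
    ultimately have "hausdorff_premeasure f \<delta> Y \<le> hausdorff_premeasure f \<delta> X"
      using hausdorff_premeasure_Un[of \<delta> f X "Y - X"] \<open>0 < \<delta>\<close> by simp
    also have "\<dots> \<le> hausdorff_measure f X" using \<open>0 < \<delta>\<close> by (rule hausdorff_premeasure_le_measure)
    finally show "hausdorff_premeasure f \<delta> Y \<le> hausdorff_measure f X" .
  qed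
qed (rule hausdorff_measure_mono[OF assms(1)])

text \<open>The null set lies in an open set \<open>G\<close> of small volume. Vitali's lemma gives
  disjoint balls in \<open>G\<close> whose fivefold enlargements cover \<open>X\<close>, and by
  \<open>f\<close> the cost of the enlargements is at most a constant times the volume of the
  disjoint balls.\<close>

lemma hausdorff_measure_negligible:
  fixes X :: "'a::euclidean_space set"
  assumes "negligible X" "0 < c" and f: "\<And>r. 0 < r \<Longrightarrow> r \<le> 1 \<Longrightarrow> f r \<le> c * r ^ DIM('a)"
  shows "hausdorff_measure f X = 0"
proof -
  have "hausdorff_premeasure f \<delta> X \<le> ennreal e" if "0 < \<delta>" "0 < e" for \<delta> e
  proof -
    define v where "v = unit_ball_vol (real DIM('a))"
    have v: "0 < v" by (simp add: v_def)
    \<comment> \<open>The factor \<open>c * 10 ^ DIM('a) / v\<close> is the bound for the ratio of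
      cost to volume of the selected balls.\<close>
    define e' where "e' = e * v / (c * 10 ^ DIM('a))"
    have e': "0 < e'" using \<open>0 < e\<close> \<open>0 < c\<close> v by (simp add: e'_def)
    obtain G where G: "open G" "X \<subseteq> G" "G - X \<in> lmeasurable" "emeasure lebesgue (G - X) < ennreal e'"
      using sets_lebesgue_outer_open[OF negligible_imp_sets[OF \<open>negligible X\<close>] e'] by metis
    have X: "X \<in> lmeasurable" "measure lebesgue X = 0"
      using \<open>negligible X\<close> by (simp_all add: negligible_imp_measurable negligible_imp_measure0)
    have Geq: "G = X \<union> (G - X)" using G by blast
    then have G_meas: "G \<in> lmeasurable" using X G(3) fmeasurable.Un by metis
    have "measure lebesgue G \<le> measure lebesgue X + measure lebesgue (G - X)"
      using Geq measure_Un_le[of X lebesgue "G - X"] X G by auto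
    also have "\<dots> \<le> e'"
    proof -
      have "ennreal (measure lebesgue (G - X)) < ennreal e'"
        using G(4) by (simp only: emeasure_eq_measure2[OF G(3)])
      then show ?thesis
        using X e' by (simp add: ennreal_less_iff)
    qed
    finally have G_e: "measure lebesgue G \<le> e'" .
    \<comment> \<open>The enlarged ball of radius \<open>5 * r\<close> has diameter
      \<open>10 * r\<close>, which must be at most \<open>\<delta>\<close> and at most 1, the range
      of \<open>f\<close>'s bound.\<close>
    have "\<exists>r. 0 < r \<and> r \<le> min 1 \<delta> / 10 \<and> cball x r \<subseteq> G" if "x \<in> X" for x
    proof -
      obtain r where "0 < r" "cball x r \<subseteq> G" using G(1,2) \<open>x \<in> X\<close> open_contains_cball by blast
      moreover have "cball x (min r (min 1 \<delta> / 10)) \<subseteq> cball x r" by (rule subset_cball) simp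
      ultimately show ?thesis using \<open>0 < \<delta>\<close>
        by (intro exI[of _ "min r (min 1 \<delta> / 10)"]) (use order_trans in auto)
    qed
    then obtain r where r: "\<And>x. x \<in> X \<Longrightarrow> 0 < r x \<and> r x \<le> min 1 \<delta> / 10" "\<And>x. x \<in> X \<Longrightarrow> cball x (r x) \<subseteq> G"
      by metis
    obtain I where I: "countable I" "I \<subseteq> X"
      "pairwise (\<lambda>i j. disjnt (cball i (r i)) (cball j (r j))) I" "X \<subseteq> (\<Union>i\<in>I. cball i (5 * r i))"
    proof (rule Vitali_covering_lemma_cballs[where S=X and K=X and a="\<lambda>x. x" and r=r and B="min 1 \<delta> / 10"])
      show "X \<subseteq> (\<Union>i\<in>X. cball i (r i))" using r(1) by (force simp: less_imp_le)
    qed (use r(1) in blast)+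
    show ?thesis
    proof (rule hausdorff_premeasure_le[OF I(1,4)])
      show "bounded (cball i (5 * r i)) \<and> diameter (cball i (5 * r i)) \<le> \<delta>" if "i \<in> I" for i
        using r(1)[of i] that I(2) by (auto simp: diameter_cball)
      fix F assume F: "finite F" "F \<subseteq> I"
      have rF: "0 < r i" "10 * r i \<le> 1" if "i \<in> F" for i using r(1)[of i] that F I(2) by auto
      have meas_F: "(\<Sum>i\<in>F. measure lebesgue (cball i (r i))) = measure lebesgue (\<Union>i\<in>F. cball i (r i))"
        by (rule measure_UNION'[symmetric, OF F(1)]) (use pairwise_subset[OF I(3) F(2)] in auto)
      also have "\<dots> \<le> measure lebesgue G"
        using F I(2) r(2) G_meas by (intro measure_mono_fmeasurable) auto
      finally have sumF: "(\<Sum>i\<in>F. v * r i ^ DIM('a)) \<le> e'"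
        using G_e rF by (simp add: content_cball v_def less_imp_le cong: sum.cong)
      have "(\<Sum>i\<in>F. gauge_cost f (cball i (5 * r i))) \<le> (\<Sum>i\<in>F. ennreal (c * (10 * r i) ^ DIM('a)))"
      proof (rule sum_mono)
        fix i assume "i \<in> F"
        with f[of "10 * r i"] rF[of i] show "gauge_cost f (cball i (5 * r i)) \<le> ennreal (c * (10 * r i) ^ DIM('a))"
          by (simp add: gauge_cost_def diameter_cball ennreal_leI)
      qed
      also have "\<dots> = ennreal (\<Sum>i\<in>F. c * (10 * r i) ^ DIM('a))"
        using rF \<open>0 < c\<close> by (intro sum_ennreal) (simp add: less_imp_le)
      also have "(\<Sum>i\<in>F. c * (10 * r i) ^ DIM('a)) = c * 10 ^ DIM('a) / v * (\<Sum>i\<in>F. v * r i ^ DIM('a))"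
        unfolding sum_distrib_left using v by (intro sum.cong) (auto simp: power_mult_distrib)
      also have "\<dots> \<le> c * 10 ^ DIM('a) / v * e'"
        using sumF v \<open>0 < c\<close> by (intro mult_left_mono) auto
      also have "\<dots> = e" using v \<open>0 < c\<close> by (simp add: e'_def)
      finally show "(\<Sum>i\<in>F. gauge_cost f (cball i (5 * r i))) \<le> ennreal e"
        by (simp add: ennreal_leI)
    qed (use \<open>0 < \<delta>\<close> in simp)
  qed
  note small = this
  have "hausdorff_premeasure f \<delta> X \<le> 0" if "0 < \<delta>" for \<delta>
  proof (rule ennreal_le_epsilon)
    show "hausdorff_premeasure f \<delta> X \<le> 0 + ennreal e" if "0 < e" for e
      using small[OF \<open>0 < \<delta>\<close> that] by simp
  qed
  then have "hausdorff_measure f X \<le> 0"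
    unfolding hausdorff_measure_def by (intro SUP_least) simp
  then show ?thesis by simp
qed

context grid_system
begin

text \<open>A finite value would provide a cover of bounded cost at arbitrarily small scales.
  Replacing each set by a ball about one of its points, with the diameter as radius, gives the
  closed balls to which \<open>limsup_not_covered\<close> applies.\<close>

lemma hausdorff_measure_infinite:
  assumes f_lim: "(f \<longlongrightarrow> 0) (at_right 0)"
    and unbounded: "\<And>B. \<exists>\<delta>>0. B * \<delta> ^ DIM('a) \<le> f \<delta>"
    and U: "open U" "U \<in> lmeasurable" "negligible (U - E)" "U \<noteq> {}"
    and X: "{x \<in> U. \<forall>N. \<exists>S\<in>T N. x \<in> S} \<subseteq> X"
  shows "hausdorff_measure f X = \<infinity>"
proof (rule ccontr)
  assume "hausdorff_measure f X \<noteq> \<infinity>"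
  then obtain t where t: "0 \<le> t" "hausdorff_measure f X = ennreal t"
    by (cases "hausdorff_measure f X") auto
  have U0: "0 < measure lebesgue U"
    using U open_not_negligible[OF U(1,4)] negligible_iff_measure[of U]
    by (simp add: zero_less_measure_iff)
  define v where "v = unit_ball_vol (real DIM('a)) * fat ^ DIM('a)"
  have v: "0 < v" using C_pos by (simp add: v_def fat_def)
  \<comment> \<open>Makes \<open>v * b * (t + 2)\<close> equal to half the volume of
    \<open>U\<close>, where \<open>t + 2\<close> will bound the total cost of the balls.\<close>
  define b where "b = measure lebesgue U / (2 * v * (t + 2))"
  have b: "0 < b" using U0 v t by (simp add: b_def)
  \<comment> \<open>One radius \<open>\<delta>\<close> of this kind suffices: \<open>f_quot\<close>
    extends the inequality to all smaller radii.\<close>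
  obtain \<delta> where \<delta>: "0 < \<delta>" "(1 / b) * \<delta> ^ DIM('a) \<le> f \<delta>" using unbounded by blast
  have quot: "r ^ DIM('a) \<le> b * f r" if "0 < r" "r \<le> \<delta>" for r
  proof -
    have "r ^ DIM('a) * f \<delta> \<le> f r * \<delta> ^ DIM('a)" using f_quot[OF that] by (simp add: mult.commute)
    also have "\<dots> \<le> f r * (b * f \<delta>)"
      using \<delta> b f_pos[OF that(1)] by (intro mult_left_mono) (auto simp: field_simps)
    finally show ?thesis using f_pos[OF \<delta>(1)] by (simp add: mult_ac)
  qed
  have "hausdorff_premeasure f \<delta> X < ennreal (t + 1)"
    by (rule le_less_trans[OF hausdorff_premeasure_le_measure[OF \<delta>(1)]])
      (use t in \<open>simp add: ennreal_less_iff\<close>)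
  then obtain V where V: "X \<subseteq> (\<Union>i. V i)" "\<And>i. bounded (V i) \<and> diameter (V i) \<le> \<delta>"
    "(\<Sum>i. gauge_cost f (V i)) < ennreal (t + 1)"
    by (rule hausdorff_premeasure_cover) blast
  \<comment> \<open>Sets of diameter zero cost nothing but need balls of positive radius. The radii
    \<open>\<eta> i\<close> add at most 1 in total, which turns \<open>t + 1\<close> into
    \<open>t + 2\<close>.\<close>
  have "\<exists>\<eta>. 0 < \<eta> \<and> \<eta> \<le> \<delta> \<and> f \<eta> \<le> (1 / 2) ^ Suc i" for i
  proof -
    have "eventually (\<lambda>r. f r < (1 / 2) ^ Suc i) (at_right 0)"
      by (rule order_tendstoD(2)[OF f_lim]) simp
    then obtain b where "0 < b" "\<And>r. 0 < r \<Longrightarrow> r < b \<Longrightarrow> f r < (1 / 2) ^ Suc i"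
      unfolding eventually_at_right_field by blast
    then show ?thesis using \<delta>(1)
      by (intro exI[of _ "min \<delta> (b / 2)"]) (auto intro!: less_imp_le)
  qed
  then obtain \<eta> where \<eta>: "\<And>i. 0 < \<eta> i" "\<And>i. \<eta> i \<le> \<delta>" "\<And>i. f (\<eta> i) \<le> (1 / 2) ^ Suc i" by metis
  define d where "d i = (if diameter (V i) = 0 then \<eta> i else diameter (V i))" for i
  define u where "u i = (SOME x. x \<in> V i)" for i
  have d: "0 < d i" "d i \<le> \<delta>" for i
    using V(2)[of i] \<eta>(1,2)[of i] diameter_ge_0[of "V i"] by (auto simp: d_def)
  have cover: "V i \<subseteq> cball (u i) (d i)" for i
  proof
    fix x assume x: "x \<in> V i"
    then have "u i \<in> V i" unfolding u_def by (rule someI)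
    then have "dist (u i) x \<le> diameter (V i)" using x V(2) by (intro diameter_bounded_bound) auto
    also have "\<dots> \<le> d i" using \<eta>(1)[of i] by (auto simp: d_def)
    finally show "x \<in> cball (u i) (d i)" by simp
  qed
  have fd: "0 \<le> f (d i)" for i using f_pos[OF d(1)] by (simp add: less_imp_le)
  have cost: "ennreal (f (d i)) \<le> gauge_cost f (V i) + ennreal ((1 / 2) ^ Suc i)" for i
    using \<eta>(3)[of i] by (auto simp: d_def gauge_cost_def ennreal_leI)
  have fin: "(\<Sum>i\<in>F. f (d i)) \<le> t + 2" if "finite F" for F
  proof -
    have "ennreal (\<Sum>i\<in>F. f (d i)) = (\<Sum>i\<in>F. ennreal (f (d i)))"
      using fd by simp
    also have "\<dots> \<le> (\<Sum>i. ennreal (f (d i)))"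
      using that by (intro sum_le_suminf) auto
    also have "\<dots> \<le> (\<Sum>i. gauge_cost f (V i) + ennreal ((1 / 2) ^ Suc i))"
      using cost by (intro suminf_le) auto
    also have "\<dots> = (\<Sum>i. gauge_cost f (V i)) + (\<Sum>i. ennreal ((1 / 2) ^ Suc i))"
      by (rule suminf_add[symmetric]) auto
    also have "(\<Sum>i. ennreal ((1 / 2) ^ Suc i)) = ennreal 1"
      by (rule suminf_ennreal_eq[OF _ power_half_series]) simp
    also have "(\<Sum>i. gauge_cost f (V i)) + ennreal 1 \<le> ennreal (t + 1) + ennreal 1"
      using V(3) by (intro add_right_mono) simp
    also have "\<dots> = ennreal (t + 2)" using t by (subst ennreal_plus[symmetric]) auto
    finally show ?thesis using t by (subst (asm) ennreal_le_iff) auto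
  qed
  have summ: "(\<lambda>i. f (d i)) summable_on UNIV"
    using fd fin by (intro nonneg_bdd_above_summable_on) (auto intro!: bdd_aboveI[of _ "t + 2"])
  have "infsum (\<lambda>i. f (d i)) UNIV \<le> t + 2"
    using fin by (intro infsum_le_finite_sums summ) auto
  then have "v * b * infsum (\<lambda>i. f (d i)) UNIV \<le> v * b * (t + 2)"
    using v b by (intro mult_left_mono) auto
  also have "\<dots> = measure lebesgue U / 2"
    using v t add_nonneg_pos[of t 2] by (simp add: b_def nonzero_divide_eq_eq)
  also have "\<dots> < measure lebesgue U" using U0 by simp
  finally have less: "v * b * infsum (\<lambda>i. f (d i)) UNIV < measure lebesgue U" .
  obtain x where "x \<in> U" "\<forall>N. \<exists>S\<in>T N. x \<in> S" and x: "x \<notin> (\<Union>k. cball (u k) (d k))"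
    using limsup_not_covered[OF f_lim U(1-3) d(1) summ quot[OF d] less_imp_le[OF b] less[unfolded v_def]]
    by blast
  then have "x \<in> X" using X by blast
  then obtain i where "x \<in> V i" using V(1) by blast
  then show False using x cover[of i] by blast
qed

end

subsection \<open>Neighbourhoods of rational planes\<close>

lemma infnorm_less_iff_cart:
  "infnorm (v :: real ^ 'm) < b \<longleftrightarrow> (\<forall>j. \<bar>v $ j\<bar> < b)"
proof -
  have "infnorm v = Max (range (\<lambda>j. \<bar>v $ j\<bar>))"
    by (simp add: infnorm_cart full_SetCompr_eq cSup_eq_Max)
  then show ?thesis by (auto simp: Max_less_iff)
qed

text \<open>The row \<open>i\<close> of largest coefficient is the one solved for when a point is
  moved onto a plane.\<close>

lemma int_supnorm_attained:
  fixes q :: "int ^ 'n"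
  obtains i where "\<And>l. \<bar>q $ l\<bar> \<le> \<bar>q $ i\<bar>" "real (int_supnorm q) = \<bar>real_of_int (q $ i)\<bar>"
proof -
  have "int_supnorm q \<in> range (\<lambda>i. nat \<bar>q $ i\<bar>)"
    unfolding int_supnorm_def by (rule Max_in) auto
  then obtain i where i: "int_supnorm q = nat \<bar>q $ i\<bar>" by blast
  have "nat \<bar>q $ l\<bar> \<le> int_supnorm q" for l
    unfolding int_supnorm_def by (rule Max_ge) auto
  with i have "\<bar>q $ l\<bar> \<le> \<bar>q $ i\<bar>" for l by (simp add: nat_le_eq_zle)
  moreover have "real (int_supnorm q) = \<bar>real_of_int (q $ i)\<bar>" using i by simp
  ultimately show ?thesis by (rule that)
qed

lemma finite_int_vec_bounded: "finite {v :: int ^ 'm. \<forall>j. \<bar>v $ j\<bar> \<le> B}"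
proof (rule finite_subset)
  show "{v :: int ^ 'm. \<forall>j. \<bar>v $ j\<bar> \<le> B} \<subseteq> vec_lambda ` (PiE UNIV (\<lambda>_. {-B..B}))"
  proof
    fix v :: "int ^ 'm" assume v: "v \<in> {v. \<forall>j. \<bar>v $ j\<bar> \<le> B}"
    have "- B \<le> v $ j \<and> v $ j \<le> B" for j
      using v abs_le_iff[of "v $ j" B] by (auto simp: minus_le_iff)
    then have "vec_nth v \<in> PiE UNIV (\<lambda>_. {-B..B})" by auto
    moreover have "v = vec_lambda (vec_nth v)" by simp
    ultimately show "v \<in> vec_lambda ` (PiE UNIV (\<lambda>_. {-B..B}))" by blast
  qed
qed (auto intro!: finite_PiE)

text \<open>For \<open>q \<noteq> 0\<close> a neighbourhood of the affine plane
  \<open>qx + p = y\<close>, of width about \<open>\<phi>(|q|)/|q|\<close>. It is not cut down to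
  the cube, so it is open.\<close>

definition strip :: "real ^ 'm \<Rightarrow> (nat \<Rightarrow> real) \<Rightarrow> int ^ 'm \<Rightarrow> int ^ 'n \<Rightarrow> (real ^ 'm ^ 'n) set" where
  "strip y \<phi> p q = {x. infnorm (real_vec q v* x + real_vec p - y) < \<phi> (int_supnorm q)}"

lemma mem_strip:
  "x \<in> strip y \<phi> p q \<longleftrightarrow>
    (\<forall>j. \<bar>(\<Sum>l\<in>UNIV. q $ l * x $ l $ j) + p $ j - y $ j\<bar> < \<phi> (int_supnorm q))"
  by (simp add: strip_def infnorm_less_iff_cart vector_matrix_mult_def real_vec_def)

lemma open_strip: "open (strip y \<phi> p q)"
proof -
  have "strip y \<phi> p q = (\<Inter>j. {x. \<bar>(\<Sum>l\<in>UNIV. q $ l * x $ l $ j) + p $ j - y $ j\<bar> < \<phi> (int_supnorm q)})"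
    by (auto simp: mem_strip)
  moreover have "open {x :: real^'a^'b. \<bar>(\<Sum>l\<in>UNIV. q $ l * x $ l $ j) + p $ j - y $ j\<bar> < \<phi> (int_supnorm q)}" for j
    by (intro open_Collect_less continuous_intros)
  ultimately show ?thesis by (simp add: open_INT)
qed

text \<open>For fixed \<open>x\<close> each \<open>q\<close> admits only finitely many
  \<open>p\<close>, and only finitely many \<open>q\<close> have bounded norm. Hence infinitely many
  solutions means solutions with arbitrarily large norm of \<open>q\<close>, which exhibits a limsup
  set of open sets.\<close>

lemma approximable_eq:
  fixes y :: "real ^ 'm"
  shows "(approximable y \<phi> :: (real ^ 'm ^ 'n) set) = {x \<in> unit_cube. \<forall>N. \<exists>p q. N \<le> int_supnorm q \<and> x \<in> strip y \<phi> p q}"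
proof -
  have "infinite {(p, q). (p, q) \<noteq> (0, 0) \<and> x \<in> strip y \<phi> p q} \<longleftrightarrow>
      (\<forall>N. \<exists>p q. N \<le> int_supnorm q \<and> x \<in> strip y \<phi> p q)" (is "infinite ?A \<longleftrightarrow> ?R") for x :: "real^'m^'n"
  proof
    assume inf: "infinite ?A"
    show ?R
    proof (rule ccontr)
      assume "\<not> ?R"
      then obtain N where N: "\<And>p q. x \<in> strip y \<phi> p q \<Longrightarrow> int_supnorm q < N"
        by (meson not_less)
      define Q where "Q = {q :: int^'n. \<forall>l. \<bar>q $ l\<bar> \<le> int N}"
      define P where "P q = {p. x \<in> strip y \<phi> p q}" for q
      have "finite (P q)" for q
      proof -
        define B where "B = \<phi> (int_supnorm q) + (\<Sum>j\<in>UNIV. \<bar>(\<Sum>l\<in>UNIV. q $ l * x $ l $ j) - y $ j\<bar>)"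
        have "\<bar>p $ j\<bar> \<le> \<lceil>B\<rceil>" if "x \<in> strip y \<phi> p q" for p j
        proof -
          have "\<bar>(\<Sum>l\<in>UNIV. q $ l * x $ l $ j) - y $ j\<bar> \<le> (\<Sum>j\<in>UNIV. \<bar>(\<Sum>l\<in>UNIV. q $ l * x $ l $ j) - y $ j\<bar>)"
            by (rule member_le_sum) auto
          moreover have "\<bar>(\<Sum>l\<in>UNIV. q $ l * x $ l $ j) + p $ j - y $ j\<bar> < \<phi> (int_supnorm q)"
            using that by (simp add: mem_strip)
          ultimately have "real_of_int \<bar>p $ j\<bar> \<le> B" unfolding B_def by linarith
          then show ?thesis by linarith
        qed
        then show ?thesis
          unfolding P_def by (intro finite_subset[OF _ finite_int_vec_bounded[of "\<lceil>B\<rceil>"]]) blast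
      qed
      moreover have "finite Q" unfolding Q_def by (rule finite_int_vec_bounded)
      moreover have "?A \<subseteq> (\<Union>q\<in>Q. P q \<times> {q})"
      proof
        fix t assume "t \<in> ?A"
        then obtain p q where t: "t = (p, q)" and pq: "x \<in> strip y \<phi> p q" by blast
        obtain i where i: "\<And>l. \<bar>q $ l\<bar> \<le> \<bar>q $ i\<bar>" "real (int_supnorm q) = \<bar>real_of_int (q $ i)\<bar>"
          using int_supnorm_attained[of q] by blast
        have "\<bar>q $ i\<bar> \<le> int N" using N[OF pq] i(2) by linarith
        then have "q \<in> Q" unfolding Q_def using order_trans[OF i(1)] by simp
        with pq t show "t \<in> (\<Union>q\<in>Q. P q \<times> {q})" by (simp add: P_def)
      qed
      ultimately have "finite ?A" by (meson finite_SigmaI finite_UN_I finite.emptyI finite.insertI finite_subset)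
      with inf show False ..
    qed
  next
    assume R: ?R
    show "infinite ?A"
    proof
      assume fin: "finite ?A"
      \<comment> \<open>As a sum over all solutions, \<open>N\<close> is at least the norm of each;
        asking for \<open>Suc N\<close> contradicts this and also forces \<open>q\<close> to be
        nonzero.\<close>
      define N where "N = (\<Sum>t\<in>?A. int_supnorm (snd t))"
      obtain p q where pq: "Suc N \<le> int_supnorm q" "x \<in> strip y \<phi> p q" using R by blast
      have "int_supnorm (0 :: int^'n) = 0" by (simp add: int_supnorm_def)
      with pq(1) have "q \<noteq> 0" by auto
      with pq(2) have "(p, q) \<in> ?A" by auto
      then have "int_supnorm q \<le> N"
        using member_le_sum[OF _ _ fin, of "(p, q)" "\<lambda>t. int_supnorm (snd t)"] by (simp add: N_def)
      with pq(1) show False by simp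
    qed
  qed
  then show ?thesis unfolding approximable_def strip_def by auto
qed

section \<open>Points and grids on rational planes\<close>

lemma norm_matrix_le:
  fixes w :: "real ^ 'm ^ 'n"
  assumes "\<And>l j. \<bar>w $ l $ j\<bar> \<le> b"
  shows "norm w \<le> real (CARD('n) * CARD('m)) * b"
proof -
  have "norm (w $ l) \<le> real CARD('m) * b" for l
    using norm_le_l1_cart[of "w $ l"] sum_bounded_above[of UNIV "\<lambda>j. \<bar>w $ l $ j\<bar>" b] assms by force
  then have "(\<Sum>l\<in>UNIV. norm (w $ l)) \<le> real CARD('n) * (real CARD('m) * b)"
    by (intro sum_bounded_above)
  moreover have "norm w \<le> (\<Sum>l\<in>UNIV. norm (w $ l))"
    unfolding norm_vec_def by (rule L2_set_le_sum) simp
  ultimately show ?thesis by (simp add: mult.assoc)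
qed

lemma entry_le_norm: "\<bar>(w :: real ^ 'm ^ 'n) $ l $ j\<bar> \<le> norm w"
  using component_le_norm_cart[of "w $ l" j] Finite_Cartesian_Product.norm_nth_le[of w l] by linarith

text \<open>Each of the \<open>n\<close> summands of a coordinate of \<open>qx\<close> changes by at
  most \<open>\<psi>(|q|)/(2n)\<close>, so the coordinate changes by at most half of
  \<open>\<psi>(|q|)\<close>.\<close>

lemma cball_subset_strip:
  fixes z :: "real ^ 'm ^ 'n"
  assumes plane: "\<And>j. (\<Sum>l\<in>UNIV. q $ l * z $ l $ j) + p $ j = y $ j"
    and pos: "0 < \<psi> (int_supnorm q)"
    and q: "1 \<le> int_supnorm q"
  shows "cball z (1 / (2 * real CARD('n)) * (\<psi> (int_supnorm q) / int_supnorm q)) \<subseteq> strip y \<psi> p q"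
proof
  let ?\<psi> = "\<psi> (int_supnorm q)" and ?Q = "real (int_supnorm q)" and ?n = "real CARD('n)"
  fix w assume "w \<in> cball z (1 / (2 * real CARD('n)) * (?\<psi> / ?Q))"
  then have w: "norm (w - z) \<le> ?\<psi> / ?Q / (2 * ?n)"
    by (simp add: dist_norm norm_minus_commute field_simps)
  obtain i where i: "\<And>l. \<bar>q $ l\<bar> \<le> \<bar>q $ i\<bar>" "?Q = \<bar>real_of_int (q $ i)\<bar>"
    using int_supnorm_attained[of q] by blast
  have "\<bar>(\<Sum>l\<in>UNIV. q $ l * w $ l $ j) + p $ j - y $ j\<bar> < ?\<psi>" for j
  proof -
    have "(\<Sum>l\<in>UNIV. q $ l * w $ l $ j) + p $ j - y $ j = (\<Sum>l\<in>UNIV. q $ l * (w - z) $ l $ j)"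
      using plane[of j] by (simp add: algebra_simps sum_subtractf)
    also have "\<bar>\<dots>\<bar> \<le> (\<Sum>l\<in>(UNIV :: 'n set). \<bar>q $ l * (w - z) $ l $ j\<bar>)"
      by (rule sum_abs)
    also have "\<dots> \<le> (\<Sum>l\<in>(UNIV :: 'n set). ?Q * (?\<psi> / ?Q / (2 * ?n)))"
    proof (rule sum_mono)
      fix l
      have "real_of_int \<bar>q $ l\<bar> \<le> ?Q" using i(1)[of l] i(2) by linarith
      moreover have "\<bar>(w - z) $ l $ j\<bar> \<le> ?\<psi> / ?Q / (2 * ?n)"
        using entry_le_norm[of "w - z" l j] w by linarith
      ultimately have "\<bar>real_of_int (q $ l)\<bar> * \<bar>(w - z) $ l $ j\<bar> \<le> ?Q * (?\<psi> / ?Q / (2 * ?n))"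
        by (intro mult_mono) auto
      then show "\<bar>q $ l * (w - z) $ l $ j\<bar> \<le> ?Q * (?\<psi> / ?Q / (2 * ?n))"
        by (simp only: abs_mult)
    qed
    also have "\<dots> = ?\<psi> / 2" using q by simp
    also have "\<dots> < ?\<psi>" using pos by simp
    finally show ?thesis .
  qed
  then show "w \<in> strip y \<psi> p q" by (simp add: mem_strip)
qed

text \<open>All rows except \<open>i\<close> are displaced freely by \<open>v\<close>, and row
  \<open>i\<close> is solved for. As \<open>q $ i\<close> is the largest coefficient, the correction
  is at most \<open>n * \<rho>\<close>: one \<open>\<rho>\<close> from \<open>near\<close> and
  \<open>n - 1\<close> from the displaced rows.\<close>

lemma plane_point:
  fixes x :: "real ^ 'm ^ 'n" and p :: "int ^ 'm" and q :: "int ^ 'n"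
  assumes i: "\<And>l. \<bar>q $ l\<bar> \<le> \<bar>q $ i\<bar>" "q $ i \<noteq> 0"
    and near: "\<And>j. \<bar>(\<Sum>l\<in>UNIV. q $ l * x $ l $ j) + p $ j - y $ j\<bar> \<le> \<bar>real_of_int (q $ i)\<bar> * \<rho>"
    and v: "\<And>l j. \<bar>v l j\<bar> \<le> \<rho>"
  obtains z where "\<And>l j. l \<noteq> i \<Longrightarrow> z $ l $ j = x $ l $ j + v l j"
    "\<And>j. (\<Sum>l\<in>UNIV. q $ l * z $ l $ j) + p $ j = y $ j"
    "\<And>l j. \<bar>(z - x) $ l $ j\<bar> \<le> real CARD('n) * \<rho>"
proof -
  let ?Q = "\<bar>real_of_int (q $ i)\<bar>"
  define \<delta> where "\<delta> j = (\<Sum>l\<in>UNIV. q $ l * x $ l $ j) + p $ j - y $ j" for j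
  \<comment> \<open>The displacement of the entry in row \<open>i\<close> that makes equation
    \<open>j\<close> hold.\<close>
  define e where "e j = - (\<delta> j + (\<Sum>l\<in>UNIV - {i}. q $ l * v l j)) / q $ i" for j
  define z where "z = (\<chi> l j. x $ l $ j + (if l = i then e j else v l j))"
  have \<rho>: "0 \<le> \<rho>" using v[of undefined undefined] by linarith
  have Q: "0 < ?Q" using i(2) by simp
  have z: "z $ l $ j = x $ l $ j + (if l = i then e j else v l j)" for l j
    by (simp add: z_def)
  have 1: "(\<Sum>l\<in>UNIV. q $ l * z $ l $ j) + p $ j = y $ j" for j
  proof -
    have "(\<Sum>l\<in>UNIV. q $ l * z $ l $ j) =
        (\<Sum>l\<in>UNIV. q $ l * x $ l $ j) + (\<Sum>l\<in>UNIV. q $ l * (if l = i then e j else v l j))"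
      by (simp add: z algebra_simps sum.distrib)
    also have "(\<Sum>l\<in>UNIV. q $ l * (if l = i then e j else v l j)) = q $ i * e j + (\<Sum>l\<in>UNIV - {i}. q $ l * v l j)"
      by (subst sum.remove[of _ i]) (auto intro!: sum.cong)
    also have "\<dots> = - \<delta> j" using i(2) by (simp add: e_def)
    finally show ?thesis by (simp add: \<delta>_def)
  qed
  have n1: "1 \<le> real CARD('n)" using zero_less_card_finite[where 'a='n] by linarith
  have v_le: "\<bar>v l j\<bar> \<le> real CARD('n) * \<rho>" for l j
    using v[of l j] mult_right_mono[OF n1 \<rho>] by simp
  have e_le: "\<bar>e j\<bar> \<le> real CARD('n) * \<rho>" for j
  proof -
    have "\<bar>q $ l * v l j\<bar> \<le> ?Q * \<rho>" for l
    proof -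
      have "real_of_int \<bar>q $ l\<bar> \<le> ?Q" using i(1)[of l] by linarith
      then have "\<bar>real_of_int (q $ l)\<bar> * \<bar>v l j\<bar> \<le> ?Q * \<rho>"
        using v[of l j] by (intro mult_mono) auto
      then show ?thesis by (simp only: abs_mult)
    qed
    then have "(\<Sum>l\<in>UNIV - {i}. \<bar>q $ l * v l j\<bar>) \<le> real (card (UNIV - {i})) * (?Q * \<rho>)"
      by (intro sum_bounded_above)
    moreover have "real (card (UNIV - {i})) = real CARD('n) - 1"
      using n1 by (simp add: card_Diff_singleton of_nat_diff)
    ultimately have "\<bar>\<Sum>l\<in>UNIV - {i}. q $ l * v l j\<bar> \<le> (real CARD('n) - 1) * (?Q * \<rho>)"
      using order_trans[OF sum_abs] by metis
    moreover have "\<bar>\<delta> j\<bar> \<le> ?Q * \<rho>" using near[of j] by (simp add: \<delta>_def)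
    ultimately have "\<bar>\<delta> j + (\<Sum>l\<in>UNIV - {i}. q $ l * v l j)\<bar> \<le> ?Q * (real CARD('n) * \<rho>)"
      by (simp add: algebra_simps)
    then show ?thesis using Q by (simp add: e_def abs_divide pos_divide_le_eq mult.commute)
  qed
  show ?thesis
  proof (rule that[of z])
    show "\<bar>(z - x) $ l $ j\<bar> \<le> real CARD('n) * \<rho>" for l j
      using v_le e_le by (simp add: z)
    show "z $ l $ j = x $ l $ j + v l j" if "l \<noteq> i" for l j using that by (simp add: z)
    show "(\<Sum>l\<in>UNIV. q $ l * z $ l $ j) + p $ j = y $ j" for j by (rule 1)
  qed
qed

lemma card_nat_near:
  assumes "0 \<le> L"
  shows "finite {k :: nat. \<bar>real k - real b\<bar> \<le> L}" "real (card {k :: nat. \<bar>real k - real b\<bar> \<le> L}) \<le> 2 * L + 1"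
proof -
  let ?A = "{k :: nat. \<bar>real k - real b\<bar> \<le> L}" and ?B = "{int b - \<lfloor>L\<rfloor>..int b + \<lfloor>L\<rfloor>}"
  have "int k \<in> ?B" if "k \<in> ?A" for k
  proof -
    have "real_of_int (int k - int b) \<le> L" "real_of_int (int b - int k) \<le> L"
      using that by auto
    then have "int k - int b \<le> \<lfloor>L\<rfloor>" "int b - int k \<le> \<lfloor>L\<rfloor>"
      by (simp_all only: le_floor_iff)
    then show ?thesis by simp
  qed
  then have "int ` ?A \<subseteq> ?B" by blast
  then have "card (int ` ?A) \<le> card ?B" "finite (int ` ?A)"
    using card_mono[of ?B "int ` ?A"] finite_subset[of "int ` ?A" ?B] by simp_all
  then have "card ?A \<le> card ?B" and fin: "finite ?A"
    by (auto simp: card_image finite_image_iff)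
  show "finite ?A" by (rule fin)
  have "real (card ?B) = 2 * real_of_int \<lfloor>L\<rfloor> + 1"
    using \<open>0 \<le> L\<close> by simp
  with \<open>card ?A \<le> card ?B\<close> show "real (card ?A) \<le> 2 * L + 1"
    using of_int_floor_le[of L] by linarith
qed

text \<open>The plane is parametrised by the entries outside row \<open>i\<close>, and the grid
  takes \<open>M\<close> equally spaced values with step \<open>r\<close> for each of these
  \<open>m * (n - 1)\<close> entries. For \<open>n = 1\<close> it is a single point.\<close>

lemma plane_grid:
  fixes x :: "real ^ 'm ^ 'n" and p :: "int ^ 'm" and q :: "int ^ 'n"
  assumes i: "\<And>l. \<bar>q $ l\<bar> \<le> \<bar>q $ i\<bar>" "q $ i \<noteq> 0"
    and near: "\<And>j. \<bar>(\<Sum>l\<in>UNIV. q $ l * x $ l $ j) + p $ j - y $ j\<bar> \<le> \<bar>real_of_int (q $ i)\<bar> * \<rho>"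
    and r: "0 < r" "r \<le> \<rho>" and \<kappa>: "\<kappa> \<le> 1 / 2"
  obtains Z where "finite Z" "(\<rho> / (2 * r)) ^ (CARD('m) * (CARD('n) - 1)) \<le> card Z"
    "Z \<subseteq> cball x (real (CARD('n) * CARD('m)) * real CARD('n) * \<rho>)"
    "\<And>z j. z \<in> Z \<Longrightarrow> (\<Sum>l\<in>UNIV. q $ l * z $ l $ j) + p $ j = y $ j"
    "\<And>u d. 0 \<le> d \<Longrightarrow> card {z \<in> Z. dist z u \<le> d + \<kappa> * r} \<le> (4 * d / r + 3) ^ (CARD('m) * (CARD('n) - 1))"
proof -
  \<comment> \<open>Since \<open>r \<le> \<rho>\<close>, rounding down loses at most a factor 2, and
    the displacements stay below \<open>\<rho>\<close>.\<close>
  define M where "M = nat \<lfloor>\<rho> / r\<rfloor>"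
  define J where "J = (UNIV - {i}) \<times> (UNIV :: 'm set)"
  have cardJ: "card J = CARD('m) * (CARD('n) - 1)"
    by (simp add: J_def card_cartesian_product card_Diff_singleton mult.commute)
  have \<rho>r: "1 \<le> \<rho> / r" using r by simp
  have M_le: "real M * r \<le> \<rho>"
  proof -
    have "real M \<le> \<rho> / r" using \<rho>r by (simp add: M_def)
    then show ?thesis using r by (simp add: field_simps)
  qed
  have M_ge: "\<rho> / (2 * r) \<le> real M"
  proof -
    have "1 \<le> \<lfloor>\<rho> / r\<rfloor>" using \<rho>r by simp
    then have "1 \<le> real M" "\<rho> / r < real M + 1"
      unfolding M_def by linarith+
    then show ?thesis by (simp add: field_simps)
  qed
  define G where "G = PiE J (\<lambda>_. {..<M})"
  have "finite J" by simp
  have G: "finite G" "card G = M ^ card J"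
    using \<open>finite J\<close> by (auto simp: G_def finite_PiE card_PiE)
  define good where "good a z \<longleftrightarrow> (\<forall>l j. l \<noteq> i \<longrightarrow> z $ l $ j = x $ l $ j + r * real (a (l, j))) \<and>
      (\<forall>j. (\<Sum>l\<in>UNIV. q $ l * z $ l $ j) + p $ j = y $ j) \<and>
      (\<forall>l j. \<bar>(z - x) $ l $ j\<bar> \<le> real CARD('n) * \<rho>)" for a z
  have "\<exists>z. good a z" if a: "a \<in> G" for a
  proof -
    define v where "v l j = (if l = i then 0 else r * real (a (l, j)))" for l j
    have v: "\<bar>v l j\<bar> \<le> \<rho>" for l j
    proof (cases "l = i")
      case False
      then have "a (l, j) < M" using a by (auto simp: G_def J_def)
      then have "r * real (a (l, j)) \<le> r * real M" using r by (intro mult_left_mono) auto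
      also have "\<dots> \<le> \<rho>" using M_le by (simp add: mult.commute)
      finally show ?thesis using False r by (simp add: v_def)
    qed (use r in \<open>simp add: v_def\<close>)
    obtain z where "\<And>l j. l \<noteq> i \<Longrightarrow> z $ l $ j = x $ l $ j + v l j"
      "\<And>j. (\<Sum>l\<in>UNIV. q $ l * z $ l $ j) + p $ j = y $ j"
      "\<And>l j. \<bar>(z - x) $ l $ j\<bar> \<le> real CARD('n) * \<rho>"
      by (rule plane_point[where v=v, OF i near v]) blast
    then have "good a z" by (simp add: good_def v_def)
    then show ?thesis ..
  qed
  then obtain \<zeta> where good: "\<And>a. a \<in> G \<Longrightarrow> good a (\<zeta> a)" by metis
  then have \<zeta>: "\<And>a l j. a \<in> G \<Longrightarrow> l \<noteq> i \<Longrightarrow> \<zeta> a $ l $ j = x $ l $ j + r * real (a (l, j))"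
    "\<And>a j. a \<in> G \<Longrightarrow> (\<Sum>l\<in>UNIV. q $ l * \<zeta> a $ l $ j) + p $ j = y $ j"
    "\<And>a l j. a \<in> G \<Longrightarrow> \<bar>(\<zeta> a - x) $ l $ j\<bar> \<le> real CARD('n) * \<rho>"
    by (simp_all add: good_def)
  have inj: "inj_on \<zeta> G"
  proof (rule inj_onI)
    fix a b assume ab: "a \<in> G" "b \<in> G" "\<zeta> a = \<zeta> b"
    show "a = b"
    proof (rule PiE_ext[OF ab(1,2)[unfolded G_def]])
      fix s assume "s \<in> J"
      then obtain l j where s: "s = (l, j)" "l \<noteq> i" by (auto simp: J_def)
      have "r * real (a (l, j)) = r * real (b (l, j))"
        using \<zeta>(1)[OF ab(1) s(2), of j] \<zeta>(1)[OF ab(2) s(2), of j] unfolding ab(3) by linarith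
      then show "a s = b s" using r s by simp
    qed
  qed
  show ?thesis
  proof (rule that[of "\<zeta> ` G"])
    show "finite (\<zeta> ` G)" using G by simp
    show "(\<rho> / (2 * r)) ^ (CARD('m) * (CARD('n) - 1)) \<le> card (\<zeta> ` G)"
      using power_mono[OF M_ge, of "card J"] r by (simp add: card_image[OF inj] G(2) cardJ)
    show "\<zeta> ` G \<subseteq> cball x (real (CARD('n) * CARD('m)) * real CARD('n) * \<rho>)"
      using norm_matrix_le[OF \<zeta>(3)] by (auto simp: dist_norm norm_minus_commute mult.assoc)
    show "(\<Sum>l\<in>UNIV. q $ l * z $ l $ j) + p $ j = y $ j" if "z \<in> \<zeta> ` G" for z j
      using that \<zeta>(2) by blast
    fix u and d :: real assume "0 \<le> d"
    let ?A = "{a \<in> G. dist (\<zeta> a) u \<le> d + \<kappa> * r}"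
    have "{z \<in> \<zeta> ` G. dist z u \<le> d + \<kappa> * r} = \<zeta> ` ?A" by blast
    then have "card {z \<in> \<zeta> ` G. dist z u \<le> d + \<kappa> * r} = card ?A"
      using inj by (simp add: card_image inj_on_subset)
    also have "real (card ?A) \<le> (4 * d / r + 3) ^ card J"
    proof (cases "?A = {}")
      case True
      then show ?thesis unfolding True using \<open>0 \<le> d\<close> r by simp
    next
      case False
      then obtain b where b: "b \<in> G" "dist (\<zeta> b) u \<le> d + \<kappa> * r" by blast
      \<comment> \<open>Two grid points within \<open>d + \<kappa> * r\<close> of \<open>u\<close>
        have distance at most \<open>2 * d + r\<close>, so their indices differ by at most
        \<open>L\<close>. Each index thus has at most \<open>2 * L + 1\<close> values, which is
        \<open>4 * d / r + 3\<close>.\<close>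
      define L where "L = 2 * d / r + 1"
      have L: "0 \<le> L" using \<open>0 \<le> d\<close> r by (simp add: L_def add.commute)
      define B where "B = PiE J (\<lambda>s. {k :: nat. \<bar>real k - real (b s)\<bar> \<le> L})"
      have "?A \<subseteq> B"
      proof
        fix a assume a: "a \<in> ?A"
        show "a \<in> B" unfolding B_def
        proof (rule PiE_I)
          fix s assume "s \<in> J"
          then obtain l j where s: "s = (l, j)" "l \<noteq> i" by (auto simp: J_def)
          have "dist (\<zeta> a) (\<zeta> b) \<le> 2 * d + 2 * (\<kappa> * r)"
            using a b dist_triangle2[of "\<zeta> a" "\<zeta> b" u] by auto
          moreover have "2 * (\<kappa> * r) \<le> r" using mult_right_mono[OF \<kappa>, of r] r by simp
          ultimately have "norm (\<zeta> a - \<zeta> b) \<le> 2 * d + r" by (simp add: dist_norm)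
          moreover have "(\<zeta> a - \<zeta> b) $ l $ j = r * (real (a (l, j)) - real (b (l, j)))"
            using a b s \<zeta>(1) by (simp add: algebra_simps)
          ultimately have "\<bar>r * (real (a s) - real (b s))\<bar> \<le> 2 * d + r"
            using entry_le_norm[of "\<zeta> a - \<zeta> b" l j] s by simp
          then have "r * \<bar>real (a s) - real (b s)\<bar> \<le> r * L"
            using r by (simp add: L_def abs_mult distrib_left)
          then show "a s \<in> {k. \<bar>real k - real (b s)\<bar> \<le> L}" using r by simp
        next
          fix s assume "s \<notin> J"
          then show "a s = undefined" using a by (auto simp: G_def)
        qed
      qed
      moreover have "finite B" unfolding B_def
        using \<open>finite J\<close> card_nat_near(1)[OF L] by (intro finite_PiE) auto
      ultimately have "real (card ?A) \<le> real (card B)" by (simp add: card_mono)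
      also have "\<dots> = (\<Prod>s\<in>J. real (card {k :: nat. \<bar>real k - real (b s)\<bar> \<le> L}))"
        using \<open>finite J\<close> by (simp add: B_def card_PiE)
      also have "\<dots> \<le> (\<Prod>s\<in>J. 2 * L + 1)"
        using card_nat_near(2)[OF L] by (intro prod_mono) auto
      also have "\<dots> = (4 * d / r + 3) ^ card J" by (simp add: L_def add.commute)
      finally show ?thesis .
    qed
    finally show "card {z \<in> \<zeta> ` G. dist z u \<le> d + \<kappa> * r} \<le> (4 * d / r + 3) ^ (CARD('m) * (CARD('n) - 1))"
      by (simp add: cardJ)
  qed
qed

section \<open>Lebesgue and Hausdorff measure of the approximable sets\<close>

text \<open>A density argument: disjoint Vitali balls inside an open \<open>G\<close> around
  \<open>F\<close> contain disjoint holes in \<open>G - F\<close>, each with a fixed proportion of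
  its ball's volume. If \<open>G - F\<close> is small, so is the total volume of the balls, which
  cover almost all of \<open>F\<close>.\<close>

lemma negligible_if_missing_balls:
  fixes F E :: "'a::euclidean_space set"
  assumes F: "F \<in> lmeasurable" and "negligible (F - E)" and \<kappa>: "0 < \<kappa>"
    and hole: "\<And>x e. x \<in> F \<inter> E \<Longrightarrow> 0 < e \<Longrightarrow>
      \<exists>R z s. 0 < R \<and> R < e \<and> \<kappa> * R \<le> s \<and> cball z s \<subseteq> cball x R - F"
  shows "negligible F"
proof -
  define v where "v = unit_ball_vol (real DIM('a))"
  have v: "0 < v" by (simp add: v_def)
  have bound: "measure lebesgue F \<le> 0 + \<epsilon>" if "0 < \<epsilon>" for \<epsilon>
  proof -
    \<comment> \<open>Anticipates the factor \<open>\<kappa> ^ DIM('a)\<close> between the volumes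
      of a hole and its ball.\<close>
    define \<epsilon>' where "\<epsilon>' = \<epsilon> * \<kappa> ^ DIM('a)"
    have \<epsilon>': "0 < \<epsilon>'" using \<open>0 < \<epsilon>\<close> \<kappa> by (simp add: \<epsilon>'_def)
    obtain G where G: "open G" "F \<subseteq> G" "G - F \<in> lmeasurable" "emeasure lebesgue (G - F) < ennreal \<epsilon>'"
      using sets_lebesgue_outer_open[OF fmeasurableD[OF F] \<epsilon>'] by metis
    have "ennreal (measure lebesgue (G - F)) < ennreal \<epsilon>'"
      using G(4) by (simp only: emeasure_eq_measure2[OF G(3)])
    then have GF: "measure lebesgue (G - F) \<le> \<epsilon>'"
      using \<epsilon>' by (simp add: ennreal_less_iff)
    define P where "P x R \<longleftrightarrow> cball x R \<subseteq> G \<and> (\<exists>z s. \<kappa> * R \<le> s \<and> cball z s \<subseteq> cball x R - F)" for x R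
    obtain T where T: "T \<in> lmeasurable" "measure lebesgue T \<le> \<epsilon>" "negligible (F \<inter> E - T)"
    proof (rule Vitali_measure_bound[of "F \<inter> E" P \<epsilon>])
      fix x and e :: real assume x: "x \<in> F \<inter> E" and e: "0 < e"
      obtain e' where e': "0 < e'" "cball x e' \<subseteq> G" using G(1,2) x open_contains_cball by blast
      obtain R z s where R: "0 < R" "R < min e e'" "\<kappa> * R \<le> s" "cball z s \<subseteq> cball x R - F"
        using hole[OF x, of "min e e'"] e e' by auto
      have "cball x R \<subseteq> cball x e'" using R by (intro subset_cball) simp
      with e' R have "P x R" unfolding P_def by blast
      with R show "\<exists>r>0. r < e \<and> P x r" by auto
    next
      fix K :: "('a \<times> real) set"
      assume K: "finite K" "\<And>x R. (x, R) \<in> K \<Longrightarrow> 0 < R \<and> P x R"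
        "pairwise (\<lambda>(x, r) (x', r'). disjnt (cball x r) (cball x' r')) K"
      have "\<exists>z s. \<kappa> * snd i \<le> s \<and> cball z s \<subseteq> cball (fst i) (snd i) - F" if "i \<in> K" for i
        using K(2)[of "fst i" "snd i"] that by (auto simp: P_def)
      then obtain z s where zs: "\<And>i. i \<in> K \<Longrightarrow> \<kappa> * snd i \<le> s i"
        "\<And>i. i \<in> K \<Longrightarrow> cball (z i) (s i) \<subseteq> cball (fst i) (snd i) - F" by metis
      have in_G: "cball (fst i) (snd i) \<subseteq> G" and pos: "0 < snd i" if "i \<in> K" for i
        using K(2)[of "fst i" "snd i"] that by (auto simp: P_def)
      have s: "0 \<le> s i" if "i \<in> K" for i
        using zs(1)[OF that] pos[OF that] \<kappa> by (meson less_imp_le mult_nonneg_nonneg order_trans)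
      have "disjnt (cball (z i) (s i)) (cball (z j) (s j))" if "i \<in> K" "j \<in> K" "i \<noteq> j" for i j
      proof -
        have "disjnt (cball (fst i) (snd i)) (cball (fst j) (snd j))"
          using pairwiseD[OF K(3) that] by (simp add: case_prod_unfold)
        then show ?thesis using zs(2)[OF that(1)] zs(2)[OF that(2)] unfolding disjnt_def by blast
      qed
      then have disj: "pairwise (\<lambda>i j. disjnt (cball (z i) (s i)) (cball (z j) (s j))) K"
        by (simp add: pairwise_def)
      have "\<kappa> ^ DIM('a) * (\<Sum>(x, r)\<in>K. measure lebesgue (cball x r)) =
          (\<Sum>i\<in>K. v * (\<kappa> * snd i) ^ DIM('a))"
        using pos by (simp add: sum_distrib_left case_prod_unfold content_cball v_def less_imp_le
            power_mult_distrib mult_ac cong: sum.cong)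
      also have "\<dots> \<le> (\<Sum>i\<in>K. v * s i ^ DIM('a))"
        using zs(1) pos \<kappa> v by (intro sum_mono mult_left_mono power_mono) (auto simp: less_imp_le)
      also have "\<dots> = (\<Sum>i\<in>K. measure lebesgue (cball (z i) (s i)))"
        using s by (simp add: content_cball v_def cong: sum.cong)
      also have "\<dots> = measure lebesgue (\<Union>i\<in>K. cball (z i) (s i))"
        by (rule measure_UNION'[symmetric, OF K(1) _ disj]) simp
      also have "\<dots> \<le> measure lebesgue (G - F)"
      proof (rule measure_mono_fmeasurable)
        show "(\<Union>i\<in>K. cball (z i) (s i)) \<subseteq> G - F" using zs(2) in_G by blast
        show "(\<Union>i\<in>K. cball (z i) (s i)) \<in> sets lebesgue" using K(1) by auto
      qed (rule G(3))
      also have "\<dots> \<le> \<kappa> ^ DIM('a) * \<epsilon>" using GF by (simp add: \<epsilon>'_def mult.commute)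
      finally show "(\<Sum>(x, r)\<in>K. measure lebesgue (cball x r)) \<le> \<epsilon>"
        using \<kappa> by (simp add: mult_le_cancel_left_pos)
    qed
    have "negligible (F - T)"
      by (rule negligible_subset[OF negligible_Un[OF assms(2) T(3)]]) blast
    from measure_le_of_negligible_diff[OF F T(1) this] T(2) show ?thesis by simp
  qed
  have "measure lebesgue F \<le> 0" by (rule field_le_epsilon[OF bound])
  then have "measure lebesgue F = 0" using measure_nonneg[of lebesgue F] by linarith
  with F show ?thesis by (simp add: negligible_iff_measure)
qed

text \<open>For any \<open>q\<close>, rounding by a suitable \<open>p\<close> brings every
  coordinate within distance less than 1. Taking all entries of \<open>q\<close> equal to
  \<open>r\<close> realises the norm \<open>r\<close>.\<close>

lemma approximable_eq_unit_cube:
  fixes y :: "real ^ 'm"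
  assumes big: "\<And>N. \<exists>r\<ge>N. 1 \<le> \<psi> r"
  shows "(approximable y \<psi> :: (real ^ 'm ^ 'n) set) = unit_cube"
proof -
  have "\<exists>p q. N \<le> int_supnorm q \<and> x \<in> strip y \<psi> p q" for N and x :: "real ^ 'm ^ 'n"
  proof -
    obtain r where r: "N \<le> r" "1 \<le> \<psi> r" using big by blast
    define q :: "int ^ 'n" where "q = (\<chi> l. int r)"
    have q: "int_supnorm q = r" by (simp add: int_supnorm_def q_def)
    define p :: "int ^ 'm" where "p = (\<chi> j. - \<lfloor>(\<Sum>l\<in>UNIV. q $ l * x $ l $ j) - y $ j\<rfloor>)"
    have "\<bar>(\<Sum>l\<in>UNIV. q $ l * x $ l $ j) + p $ j - y $ j\<bar> < 1" for j
      unfolding p_def by (simp, linarith)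
    then have "x \<in> strip y \<psi> p q" using r q by (auto simp: mem_strip intro: less_le_trans)
    with r q show ?thesis by blast
  qed
  then show ?thesis by (auto simp: approximable_eq)
qed

text \<open>Here \<open>\<rho> = \<theta>(|q|)/|q|\<close> and \<open>r = \<psi>(|q|)/|q|\<close>.
  Once \<open>\<psi> < 1\<close>, the bound \<open>r \<le> 1/|q|\<close> makes \<open>r\<close>
  small for large \<open>q\<close>, and then \<open>\<rho>\<close> is small because \<open>g\<close>
  tends to zero.\<close>

lemma approximable_near:
  fixes x :: "real ^ 'm ^ 'n" and g :: "real \<Rightarrow> real"
  assumes x: "x \<in> approximable y \<theta>"
    and \<theta>: "\<theta> = (\<lambda>r. real r * g (\<psi> r / real r) powr (1 / real CARD('m)))"
    and \<psi>: "\<And>r. 1 \<le> r \<Longrightarrow> 0 < \<psi> r" "\<And>r. N\<^sub>0 \<le> r \<Longrightarrow> \<psi> r < 1"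
    and g_pos: "\<And>r. 0 < r \<Longrightarrow> 0 < g r" and g_lim: "(g \<longlongrightarrow> 0) (at_right 0)"
    and "0 < e"
  obtains p :: "int ^ 'm" and q :: "int ^ 'n" and \<rho> r :: real and i where "N \<le> int_supnorm q" "1 \<le> int_supnorm q" "r = \<psi> (int_supnorm q) / int_supnorm q"
    "0 < r" "r < e" "0 < \<rho>" "\<rho> < e" "\<rho> ^ CARD('m) = g r"
    "\<And>l. \<bar>q $ l\<bar> \<le> \<bar>q $ i\<bar>" "q $ i \<noteq> 0"
    "\<And>j. \<bar>(\<Sum>l\<in>UNIV. q $ l * x $ l $ j) + p $ j - y $ j\<bar> \<le> \<bar>real_of_int (q $ i)\<bar> * \<rho>"
proof -
  have "eventually (\<lambda>r. g r < e ^ CARD('m)) (at_right 0)"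
    by (rule order_tendstoD(2)[OF g_lim]) (use \<open>0 < e\<close> in simp)
  then obtain \<delta> where \<delta>: "0 < \<delta>" "\<And>r. 0 < r \<Longrightarrow> r < \<delta> \<Longrightarrow> g r < e ^ CARD('m)"
    unfolding eventually_at_right_field by blast
  obtain M :: nat where M: "1 / min e \<delta> < real M" using reals_Archimedean2 by blast
  \<comment> \<open>Collects the requested norm, the range where \<open>\<psi> < 1\<close>, the size
    making \<open>1/|q|\<close> small, and \<open>q \<noteq> 0\<close>.\<close>
  define N' where "N' = Max {N, N\<^sub>0, M, 1}"
  have N': "N \<le> N'" "N\<^sub>0 \<le> N'" "M \<le> N'" "1 \<le> N'" by (auto simp: N'_def)
  obtain p q where pq: "N' \<le> int_supnorm q" "x \<in> strip y \<theta> p q"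
    using x unfolding approximable_eq by blast
  let ?Q = "real (int_supnorm q)"
  define r where "r = \<psi> (int_supnorm q) / ?Q"
  define \<rho> where "\<rho> = g r powr (1 / real CARD('m))"
  have Q: "N \<le> int_supnorm q" "N\<^sub>0 \<le> int_supnorm q" "M \<le> int_supnorm q" "1 \<le> int_supnorm q"
    using N' pq(1) by linarith+
  have r: "0 < r" using \<psi>(1)[OF Q(4)] Q(4) by (simp add: r_def)
  have "r < min e \<delta>"
  proof -
    have "r \<le> 1 / ?Q" unfolding r_def using \<psi>(2)[OF Q(2)] by (intro divide_right_mono) auto
    moreover have "1 / ?Q < min e \<delta>"
    proof -
      have "1 / min e \<delta> < ?Q" using M Q(3) by linarith
      moreover have "0 < min e \<delta>" "0 < ?Q" using \<open>0 < e\<close> \<delta>(1) Q(4) by auto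
      ultimately show ?thesis by (metis pos_divide_less_eq mult.commute)
    qed
    ultimately show ?thesis by linarith
  qed
  then have re: "r < e" "r < \<delta>" by auto
  have \<rho>: "0 < \<rho>" using g_pos[OF r] by (simp add: \<rho>_def)
  have \<rho>m: "\<rho> ^ CARD('m) = g r"
    using g_pos[OF r] \<rho> by (simp add: \<rho>_def powr_powr flip: powr_realpow)
  have \<rho>e: "\<rho> < e"
  proof (rule power_less_imp_less_base)
    show "\<rho> ^ CARD('m) < e ^ CARD('m)" unfolding \<rho>m using \<delta>(2)[OF r re(2)] .
  qed (use \<open>0 < e\<close> in simp)
  obtain i where i: "\<And>l. \<bar>q $ l\<bar> \<le> \<bar>q $ i\<bar>" "?Q = \<bar>real_of_int (q $ i)\<bar>"
    using int_supnorm_attained[of q] by blast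
  have "q $ i \<noteq> 0" using i(2) Q(4) by auto
  moreover have "\<bar>(\<Sum>l\<in>UNIV. q $ l * x $ l $ j) + p $ j - y $ j\<bar> \<le> \<bar>real_of_int (q $ i)\<bar> * \<rho>" for j
    using pq(2) unfolding mem_strip \<theta> i(2)[symmetric] \<rho>_def r_def by (simp add: less_imp_le)
  ultimately show ?thesis
    using that[OF Q(1) Q(4) r_def r re(1) \<rho> \<rho>e \<rho>m i(1)] by blast
qed

text \<open>Splits the ambient dimension into the dimension \<open>m * (n - 1)\<close> of a plane
  and its codimension \<open>m\<close>.\<close>

lemma card_mult_eq:
  "CARD('n::finite) * CARD('m::finite) = CARD('m) * (CARD('n) - 1) + CARD('m)"
  by (metis Suc_diff_1 add.commute mult.commute mult_Suc zero_less_card_finite)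

text \<open>The bound on \<open>g\<close> makes \<open>\<rho>\<close> at most a multiple of
  \<open>r\<close>, so a ball about a \<open>\<theta>\<close>-approximable point with radius
  comparable to \<open>r\<close> contains a proportional ball inside a \<open>\<psi>\<close>-strip.
  This is a hole in the complement of each \<open>G N\<close>.\<close>

lemma negligible_unit_cube_diff_approximable:
  fixes y :: "real ^ 'm" and g :: "real \<Rightarrow> real"
  assumes full: "negligible (unit_cube - approximable y \<theta> :: (real ^ 'm ^ 'n) set)"
    and \<theta>: "\<theta> = (\<lambda>r. real r * g (\<psi> r / real r) powr (1 / real CARD('m)))"
    and \<psi>: "\<And>r. 1 \<le> r \<Longrightarrow> 0 < \<psi> r" "\<And>r. N\<^sub>0 \<le> r \<Longrightarrow> \<psi> r < 1"
    and g_pos: "\<And>r. 0 < r \<Longrightarrow> 0 < g r" and g_lim: "(g \<longlongrightarrow> 0) (at_right 0)"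
    and g_le: "\<And>r. 0 < r \<Longrightarrow> r \<le> 1 \<Longrightarrow> g r \<le> c * r ^ CARD('m)"
  shows "negligible (unit_cube - approximable y \<psi> :: (real ^ 'm ^ 'n) set)"
proof -
  define G where "G N = (\<Union>p q. if N \<le> int_supnorm q then strip y \<psi> p q else {} :: (real ^ 'm ^ 'n) set)" for N :: nat
  have mem_G: "x \<in> G N \<longleftrightarrow> (\<exists>p q. N \<le> int_supnorm q \<and> x \<in> strip y \<psi> p q)" for x :: "real^'m^'n" and N
    by (auto simp: G_def split: if_splits)
  have "open (G N)" for N
    unfolding G_def by (intro open_UN ballI) (simp add: open_strip)
  then have meas: "unit_cube - G N \<in> lmeasurable" for N
    by (intro fmeasurableI2[OF lmeasurable_cbox]) (auto intro!: sets.Diff sets_completionI_sets borel_open)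
  \<comment> \<open>Being at least 1, \<open>c'\<close> satisfies \<open>c \<le> c' ^ m\<close>, so
    the comparison of \<open>m\<close>-th powers yields \<open>\<rho> \<le> c' * r\<close>.\<close>
  define c' where "c' = max 1 c"
  have c': "1 \<le> c'" "c \<le> c'" by (auto simp: c'_def)
  \<comment> \<open>The first summand bounds the distance from \<open>x\<close> to the plane point
    in units of \<open>r\<close>; the added 1 makes room for the ball around that point.\<close>
  define C where "C = real (CARD('n) * CARD('m)) * real CARD('n) * c' + 1"
  define \<kappa> where "\<kappa> = 1 / (2 * real CARD('n))"
  have "1 \<le> real CARD('n)" by (simp add: Suc_leI)
  then have "\<kappa> \<le> 1 / 1" unfolding \<kappa>_def by (intro divide_left_mono) linarith+
  then have \<kappa>: "0 < \<kappa>" "\<kappa> \<le> 1" by (auto simp: \<kappa>_def)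
  have C: "1 \<le> C" using c' by (simp add: C_def)
  have "negligible (unit_cube - G N)" for N
  proof (rule negligible_if_missing_balls[where E = "approximable y \<theta>" and \<kappa> = "\<kappa> / C"])
    fix x :: "real^'m^'n" and e :: real
    assume x: "x \<in> (unit_cube - G N) \<inter> approximable y \<theta>" and "0 < e"
    then have x': "x \<in> approximable y \<theta>" by simp
    have e: "0 < min 1 (e / C)" using \<open>0 < e\<close> C by simp
    obtain p :: "int ^ 'm" and q :: "int ^ 'n" and \<rho> r :: real and i where q: "N \<le> int_supnorm q" "1 \<le> int_supnorm q" "r = \<psi> (int_supnorm q) / int_supnorm q"
      and r: "0 < r" "r < min 1 (e / C)" and \<rho>: "0 < \<rho>" "\<rho> < min 1 (e / C)" "\<rho> ^ CARD('m) = g r"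
      and i: "\<And>l. \<bar>q $ l\<bar> \<le> \<bar>q $ i\<bar>" "q $ i \<noteq> 0"
      and near: "\<And>j. \<bar>(\<Sum>l\<in>UNIV. q $ l * x $ l $ j) + p $ j - y $ j\<bar> \<le> \<bar>real_of_int (q $ i)\<bar> * \<rho>"
      by (rule approximable_near[OF x' \<theta> \<psi> g_pos g_lim e, where N=N and N\<^sub>0=N\<^sub>0]) (assumption | (rule that; assumption))+
    have "\<rho> \<le> c' * r"
    proof (rule power_le_imp_le_base)
      have "\<rho> ^ Suc (CARD('m) - 1) = g r" using \<rho>(3) by simp
      also have "\<dots> \<le> c * r ^ CARD('m)" using g_le[of r] r by simp
      also have "\<dots> \<le> c' ^ CARD('m) * r ^ CARD('m)"
        using c' r self_le_power[OF c'(1), of "CARD('m)"] by (intro mult_right_mono) auto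
      also have "\<dots> = (c' * r) ^ Suc (CARD('m) - 1)" by (simp add: power_mult_distrib)
      finally show "\<rho> ^ Suc (CARD('m) - 1) \<le> (c' * r) ^ Suc (CARD('m) - 1)" .
    qed (use c' r in simp)
    obtain z where z: "\<And>j. (\<Sum>l\<in>UNIV. q $ l * z $ l $ j) + p $ j = y $ j"
      "\<And>l j. \<bar>(z - x) $ l $ j\<bar> \<le> real CARD('n) * \<rho>"
      by (rule plane_point[where v="\<lambda>_ _. 0", OF i near]) (use \<rho> in auto)
    have "dist x z \<le> real (CARD('n) * CARD('m)) * (real CARD('n) * \<rho>)"
      using norm_matrix_le[OF z(2)] by (simp add: dist_norm norm_minus_commute)
    also have "\<dots> \<le> real (CARD('n) * CARD('m)) * (real CARD('n) * (c' * r))"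
      using \<open>\<rho> \<le> c' * r\<close> by (intro mult_left_mono) auto
    also have "\<dots> = C * r - r" by (simp add: C_def algebra_simps)
    finally have xz: "dist x z + r \<le> C * r" by simp
    have "\<kappa> * r \<le> r" using \<kappa> r mult_right_mono[of \<kappa> 1 r] by simp
    have "cball z (\<kappa> * r) \<subseteq> cball x (C * r)"
    proof
      fix w assume "w \<in> cball z (\<kappa> * r)"
      then show "w \<in> cball x (C * r)"
        using dist_triangle[of x w z] xz \<open>\<kappa> * r \<le> r\<close> by simp
    qed
    moreover have "cball z (\<kappa> * r) \<subseteq> strip y \<psi> p q"
      using cball_subset_strip[where z=z and y=y and p=p and q=q and \<psi>=\<psi>, OF z(1) \<psi>(1)[OF q(2)] q(2)] unfolding \<kappa>_def q(3) .
    then have "cball z (\<kappa> * r) \<subseteq> G N" using q(1) mem_G by blast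
    ultimately have "cball z (\<kappa> * r) \<subseteq> cball x (C * r) - (unit_cube - G N)" by blast
    moreover have "C * r < e" using r C by (simp add: field_simps)
    ultimately show "\<exists>R z s. 0 < R \<and> R < e \<and> \<kappa> / C * R \<le> s \<and> cball z s \<subseteq> cball x R - (unit_cube - G N)"
      using C r by (intro exI[of _ "C * r"] exI[of _ z] exI[of _ "\<kappa> * r"]) auto
  next
    show "negligible (unit_cube - G N - approximable y \<theta>)"
      by (rule negligible_subset[OF full]) blast
  qed (use meas \<kappa> C in auto)
  then have "negligible (\<Union>N. unit_cube - G N)" by (intro negligible_countable_Union) auto
  moreover have "unit_cube - approximable y \<psi> \<subseteq> (\<Union>N. unit_cube - G N)"
    by (auto simp: approximable_eq mem_G)
  ultimately show ?thesis by (rule negligible_subset)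
qed

text \<open>Instantiates \<open>grid_system\<close> with the grids of \<open>plane_grid\<close>; the
  target sets are the \<open>\<psi>\<close>-strips with norm of \<open>q\<close> at least
  \<open>N\<close>.\<close>

lemma hausdorff_measure_approximable_infinite:
  fixes y :: "real ^ 'm" and f g :: "real \<Rightarrow> real"
  assumes full: "negligible (unit_cube - approximable y \<theta> :: (real ^ 'm ^ 'n) set)"
    and \<theta>: "\<theta> = (\<lambda>r. real r * g (\<psi> r / real r) powr (1 / real CARD('m)))"
    and \<psi>: "\<And>r. 1 \<le> r \<Longrightarrow> 0 < \<psi> r" "\<And>r. N\<^sub>0 \<le> r \<Longrightarrow> \<psi> r < 1"
    and f: "dimension_function f" and g: "dimension_function g"
    and f_eq: "\<And>r. 0 < r \<Longrightarrow> f r = r ^ (CARD('m) * (CARD('n) - 1)) * g r"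
    and f_quot: "\<And>r s. 0 < r \<Longrightarrow> r \<le> s \<Longrightarrow> f s * r ^ (CARD('n) * CARD('m)) \<le> f r * s ^ (CARD('n) * CARD('m))"
    and unbounded: "\<And>c. \<exists>r>0. c * r ^ (CARD('n) * CARD('m)) \<le> f r"
  shows "hausdorff_measure f (approximable y \<psi> :: (real ^ 'm ^ 'n) set) = \<infinity>"
proof -
  let ?k = "CARD('m) * (CARD('n) - 1)"
  have DIM: "DIM(real ^ 'm ^ 'n) = CARD('n) * CARD('m)" by simp
  note Dk = card_mult_eq[where 'm='m and 'n='n]
  define T where "T N = {strip y \<psi> p q :: (real ^ 'm ^ 'n) set | p q. N \<le> int_supnorm q}" for N :: nat
  have fg: "0 < f r" "0 < g r" if "0 < r" for r
    using f g that by (auto simp: dimension_function_def)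
  have mono: "f r \<le> f s" "g r \<le> g s" if "0 < r" "r \<le> s" for r s
    using f g that by (auto simp: dimension_function_def intro: mono_onD[of "{0<..}"])
  have lim: "(f \<longlongrightarrow> 0) (at_right 0)" "(g \<longlongrightarrow> 0) (at_right 0)"
    using f g by (auto simp: dimension_function_def)
  \<comment> \<open>With constant 1 this gives \<open>r ^ m \<le> g r\<close> below
    \<open>\<delta>\<close>, and hence \<open>r \<le> \<rho>\<close>, as the grid requires.\<close>
  obtain \<delta> where \<delta>: "0 < \<delta>" "1 * \<delta> ^ (CARD('n) * CARD('m)) \<le> f \<delta>" using unbounded by blast
  have g_ge: "r ^ CARD('m) \<le> g r" if "0 < r" "r \<le> \<delta>" for r
  proof -
    have "f \<delta> * r ^ (CARD('n) * CARD('m)) \<le> f r * \<delta> ^ (CARD('n) * CARD('m))" by (rule f_quot[OF that])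
    also have "\<dots> \<le> f r * f \<delta>" using \<delta> fg[OF that(1)] by (intro mult_left_mono) auto
    finally have "r ^ (CARD('n) * CARD('m)) \<le> f r" using fg(1)[OF \<delta>(1)] by (simp add: mult.commute)
    then show ?thesis using that f_eq[OF that(1)] unfolding Dk power_add by simp
  qed
  interpret grid_system f g ?k "real (CARD('n) * CARD('m)) * real CARD('n)" "1 / (2 * real CARD('n))" T
    "approximable y \<theta> :: (real ^ 'm ^ 'n) set"
  proof (rule grid_system.intro)
    fix x :: "real ^ 'm ^ 'n" and e :: real and N
    assume x: "x \<in> approximable y \<theta>" and "0 < e"
    then have e: "0 < min e \<delta>" using \<delta>(1) by simp
    obtain p :: "int ^ 'm" and q :: "int ^ 'n" and \<rho> r :: real and i where q: "N \<le> int_supnorm q" "1 \<le> int_supnorm q" "r = \<psi> (int_supnorm q) / int_supnorm q"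
      and r: "0 < r" "r < min e \<delta>" and \<rho>: "0 < \<rho>" "\<rho> < min e \<delta>" "\<rho> ^ CARD('m) = g r"
      and i: "\<And>l. \<bar>q $ l\<bar> \<le> \<bar>q $ i\<bar>" "q $ i \<noteq> 0"
      and near: "\<And>j. \<bar>(\<Sum>l\<in>UNIV. q $ l * x $ l $ j) + p $ j - y $ j\<bar> \<le> \<bar>real_of_int (q $ i)\<bar> * \<rho>"
      by (rule approximable_near[OF x \<theta> \<psi> fg(2) lim(2) e, where N=N and N\<^sub>0=N\<^sub>0]) (assumption | (rule that; assumption))+
    have r\<rho>: "r \<le> \<rho>"
    proof (rule power_le_imp_le_base)
      show "r ^ Suc (CARD('m) - 1) \<le> \<rho> ^ Suc (CARD('m) - 1)" using g_ge[of r] r \<rho>(3) by simp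
    qed (use \<rho> in simp)
    have \<kappa>: "1 / (2 * real CARD('n)) \<le> 1 / 2" by (simp add: field_simps)
    obtain Z where Z: "finite Z" "(\<rho> / (2 * r)) ^ ?k \<le> card Z"
      "Z \<subseteq> cball x (real (CARD('n) * CARD('m)) * real CARD('n) * \<rho>)"
      "\<And>z j. z \<in> Z \<Longrightarrow> (\<Sum>l\<in>UNIV. q $ l * z $ l $ j) + p $ j = y $ j"
      "\<And>u d. 0 \<le> d \<Longrightarrow> card {z \<in> Z. dist z u \<le> d + 1 / (2 * real CARD('n)) * r} \<le> (4 * d / r + 3) ^ ?k"
      by (rule plane_grid[OF i near r(1) r\<rho> \<kappa>]) blast
    have in_T: "\<exists>S\<in>T N. cball z (1 / (2 * real CARD('n)) * r) \<subseteq> S" if "z \<in> Z" for z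
      using cball_subset_strip[where z=z and y=y and p=p and q=q and \<psi>=\<psi>, OF Z(4)[OF that] \<psi>(1)[OF q(2)] q(2)] q(1) unfolding q(3) T_def by blast
    have "\<rho> ^ DIM(real ^ 'm ^ 'n) = \<rho> ^ ?k * g r" unfolding DIM Dk power_add \<rho>(3) ..
    then show "\<exists>r \<rho> Z. 0 < r \<and> r \<le> \<rho> \<and> \<rho> < e \<and> \<rho> ^ DIM(real ^ 'm ^ 'n) = \<rho> ^ ?k * g r \<and> finite Z \<and>
      (\<rho> / (2 * r)) ^ ?k \<le> card Z \<and> Z \<subseteq> cball x (real (CARD('n) * CARD('m)) * real CARD('n) * \<rho>) \<and>
      (\<forall>z\<in>Z. \<exists>S\<in>T N. cball z (1 / (2 * real CARD('n)) * r) \<subseteq> S) \<and>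
      (\<forall>u d. 0 \<le> d \<longrightarrow> card {z \<in> Z. dist z u \<le> d + 1 / (2 * real CARD('n)) * r} \<le> (4 * d / r + 3) ^ ?k)"
      using r(1) r\<rho> \<rho>(2) Z in_T by (intro exI[of _ r] exI[of _ \<rho>] exI[of _ Z]) simp
  qed (use fg mono f_eq f_quot in \<open>auto simp: field_simps\<close>)
  show ?thesis
  proof (rule hausdorff_measure_infinite[of "box 0 One"])
    show "\<exists>\<delta>>0. B * \<delta> ^ DIM(real ^ 'm ^ 'n) \<le> f \<delta>" for B using unbounded[of B] by simp
    show "negligible (box 0 One - approximable y \<theta> :: (real ^ 'm ^ 'n) set)"
      by (rule negligible_subset[OF full]) (use box_subset_cbox in auto)
    show "{x :: real ^ 'm ^ 'n. x \<in> box 0 One \<and> (\<forall>N. \<exists>S\<in>T N. x \<in> S)} \<subseteq> approximable y \<psi>"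
      using box_subset_cbox[of "0 :: real^'m^'n" One] unfolding approximable_eq T_def by blast
    show "box (0 :: real^'m^'n) One \<noteq> {}" by (simp add: box_ne_empty)
  qed (use lim in auto)
qed

theorem theorem5:
  fixes \<psi> \<theta> :: "nat \<Rightarrow> real"
    and f g :: "real \<Rightarrow> real"
    and y :: "real ^ 'm"
  assumes "\<And>r. r \<ge> 1 \<Longrightarrow> \<psi> r > 0"
    and "y \<in> unit_cube"
    and "g = (\<lambda>r. r powi (- (int CARD('m) * (int CARD('n) - 1))) * f r)"
    and "dimension_function f"
    and "dimension_function g"
    and "mono_on {0<..} (\<lambda>r. r powi (- (int CARD('n) * int CARD('m))) * f r) \<or>
         antimono_on {0<..} (\<lambda>r. r powi (- (int CARD('n) * int CARD('m))) * f r)"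
    and "\<theta> = (\<lambda>r. real r * g (\<psi> r / real r) powr (1 / real CARD('m)))"
    and "emeasure lebesgue (approximable y \<theta> :: (real ^ 'm ^ 'n) set) = 1"
  shows "hausdorff_measure f (approximable y \<psi> :: (real ^ 'm ^ 'n) set) =
         hausdorff_measure f (unit_cube :: (real ^ 'm ^ 'n) set)"
proof (cases "\<forall>N. \<exists>r\<ge>N. 1 \<le> \<psi> r")
  case True
  then show ?thesis using approximable_eq_unit_cube[of \<psi> y, where 'n = 'n] by simp
next
  case False
  then obtain N\<^sub>0 where \<psi>1: "\<And>r. N\<^sub>0 \<le> r \<Longrightarrow> \<psi> r < 1" by (meson not_le)
  let ?A = "approximable y \<psi> :: (real ^ 'm ^ 'n) set" and ?I = "unit_cube :: (real ^ 'm ^ 'n) set"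
  let ?D = "CARD('n) * CARD('m)" and ?k = "CARD('m) * (CARD('n) - 1)"
  have sub: "?A \<subseteq> ?I" by (auto simp: approximable_def)
  have full: "negligible (?I - approximable y \<theta>)"
  proof -
    \<comment> \<open>A set that is not measurable has \<open>emeasure\<close> zero by default, so
      the value 1 forces measurability.\<close>
    have meas: "(approximable y \<theta> :: (real ^ 'm ^ 'n) set) \<in> sets lebesgue"
      using assms(8) emeasure_notin_sets by fastforce
    have "One \<bullet> b = 1" if "b \<in> Basis" for b :: "real ^ 'm ^ 'n"
      using that by (simp add: inner_sum_left inner_Basis)
    then have "emeasure lebesgue ?I = 1" by (simp add: emeasure_lborel_cbox_eq)
    then have "emeasure lebesgue (?I - approximable y \<theta>) = 0"
      using meas assms(8) by (subst emeasure_Diff) (auto simp: approximable_def)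
    moreover have "?I - approximable y \<theta> \<in> sets lebesgue" using meas by (intro sets.Diff) auto
    ultimately have "?I - approximable y \<theta> \<in> null_sets lebesgue" by (rule null_setsI)
    then show ?thesis by (simp add: negligible_iff_null_sets)
  qed
  have f_pos: "0 < f r" and g_pos: "0 < g r" if "0 < r" for r
    using assms(4,5) that by (auto simp: dimension_function_def)
  note Dk = card_mult_eq[where 'm='m and 'n='n]
  have f_eq: "f r = r ^ ?k * g r" if "0 < r" for r
  proof -
    have "int CARD('m) * (int CARD('n) - 1) = int ?k" by (simp add: of_nat_diff)
    then show ?thesis using that unfolding assms(3) by (simp only: power_int_minus power_int_of_nat) simp
  qed
  have quot: "r powi (- (int CARD('n) * int CARD('m))) * f r = f r / r ^ ?D" for r
  proof -
    have "int CARD('n) * int CARD('m) = int ?D" by simp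
    then show ?thesis by (simp only: power_int_minus power_int_of_nat) (simp add: divide_inverse)
  qed
  show ?thesis
  proof (cases "\<exists>c. \<forall>r. 0 < r \<and> r \<le> 1 \<longrightarrow> f r \<le> c * r ^ ?D")
    case True
    then obtain c where c: "\<And>r. 0 < r \<Longrightarrow> r \<le> 1 \<Longrightarrow> f r \<le> c * r ^ ?D" by blast
    have g_le: "g r \<le> c * r ^ CARD('m)" if "0 < r" "r \<le> 1" for r
      using c[OF that] that unfolding f_eq[OF that(1)] Dk power_add by (simp add: mult.left_commute)
    have "negligible (?I - ?A)"
      by (rule negligible_unit_cube_diff_approximable[OF full assms(7) assms(1) \<psi>1 g_pos _ g_le])
        (use assms(5) in \<open>auto simp: dimension_function_def\<close>)
    then have "hausdorff_measure f (?I - ?A) = 0"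
    proof (rule hausdorff_measure_negligible)
      show "0 < c" using c[of 1] f_pos[of 1] by simp
      show "f r \<le> c * r ^ DIM(real ^ 'm ^ 'n)" if "0 < r" "r \<le> 1" for r using c[OF that] by simp
    qed
    with sub show ?thesis by (rule hausdorff_measure_eq_of_null_diff)
  next
    case False
    then have big: "\<exists>r>0. r \<le> 1 \<and> c * r ^ ?D < f r" for c by (meson not_le)
    \<comment> \<open>If the quotient increased, its value at 1 would be a bound on the whole of the
      unit interval, which is the excluded case.\<close>
    have "\<not> mono_on {0<..} (\<lambda>r. f r / r ^ ?D)"
    proof
      assume mono: "mono_on {0<..} (\<lambda>r. f r / r ^ ?D)"
      obtain r where r: "0 < r" "r \<le> 1" "f 1 * r ^ ?D < f r" using big by blast
      have "f r / r ^ ?D \<le> f 1 / 1 ^ ?D" using r by (intro mono_onD[OF mono]) auto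
      with r show False by (simp add: field_simps)
    qed
    then have anti: "antimono_on {0<..} (\<lambda>r. f r / r ^ ?D)"
      using assms(6) unfolding quot by blast
    have "hausdorff_measure f ?A = \<infinity>"
    proof (rule hausdorff_measure_approximable_infinite[OF full assms(7) assms(1) \<psi>1 assms(4,5) f_eq])
      show "f s * r ^ ?D \<le> f r * s ^ ?D" if "0 < r" "r \<le> s" for r s
      proof -
        have "f s / s ^ ?D \<le> f r / r ^ ?D"
          using anti that by (auto simp: monotone_on_def)
        then show ?thesis using that by (simp add: field_simps)
      qed
      show "\<exists>r>0. c * r ^ ?D \<le> f r" for c using big[of c] less_imp_le by blast
    qed
    moreover from this have "hausdorff_measure f ?I = \<infinity>"
      using hausdorff_measure_mono[OF sub, of f] by (simp add: top_unique)
    ultimately show ?thesis by simp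
  qed
qed

end
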